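(* Let $n\ge 3$ and $p>1$. Let $\psi\in C^2([0,+\infty))$ be positive on $(0,+\infty)$ with $\psi(0)=\psi''(0)=0$, $\psi'(0)=1$, $\psi'(r)\ge 0$ for every $r>0$, and $\liminf_{r\to+\infty}\frac{\psi'(r)}{\psi(r)}>0$. For $\alpha\in\mathbb{R}$ let $u_\alpha$ be the unique solution of $$-\frac{1}{\psi(r)^{n-1}}\left[\psi(r)^{n-1}u'(r)\right]'=|u(r)|^{p-1}u(r)\quad(r>0),\qquad u(0)=\alpha,\quad u'(0)=0.$$ Let $\alpha,\beta\ge 0$, $\alpha\ne\beta$. If $u_\alpha$ and $u_\beta$ are stable, then they do not intersect, i.e. $u_\alpha(r)\neq u_\beta(r)$ for every $r\ge 0$. In particular, nontrivial stable radial solutions are strictly positive or strictly negative, and, if $\alpha_0\in(0,+\infty]$ denotes the stability threshold, then all solutions in the set $\{u_\alpha:\alpha\in[0,\alpha_0)\}$ are ordered, i.e. any two distinct members $u_\alpha,u_\beta$ with $\alpha>\beta$ satisfy $u_\alpha(r)>u_\beta(r)$ for all $r\ge 0$.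
   Context: $(M,g)$ is the $n$-dimensional Riemannian model with pole $o$ and metric $ds^2=dr^2+\psi(r)^2d\Theta^2$ in polar coordinates $(r,\Theta)\in(0,\infty)\times\mathbb{S}^{n-1}$ around $o$ ($M$ is diffeomorphic to $\mathbb{R}^n$); $V_g$ and $\nabla_g$ are the Riemannian measure and gradient. The function $u_\alpha$ is viewed as a radial function on $M$ ($r$ = distance from $o$); it is globally defined and is a radial solution of $-\Delta_g u=|u|^{p-1}u$ on $M$. A solution $u\in C^2(M)$ of this equation is stable if $\int_M|\nabla_g\varphi|_g^2\,dV_g-p\int_M|u|^{p-1}\varphi^2\,dV_g\ge 0$ for all $\varphi\in C_c^\infty(M)$, and unstable otherwise. The stability threshold is $\alpha_0:=\sup\{\alpha\ge 0: u_\beta\text{ is stable for any }\beta\in(0,\alpha)\}\in(0,+\infty]$; it has the property that $u_\alpha$ is stable for every $\alpha\in[0,\alpha_0]$ ($\alpha$ finite) and unstable for every $\alpha>\alpha_0$. *)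

theory Defs
  imports "HOL-Analysis.Analysis"
begin

section \<open>Functions on the half-line\<close>

text \<open>The derivative on \<open>[0,\<infinity>)\<close>: one-sided at 0, two-sided elsewhere.\<close>

definition hderiv :: "(real \<Rightarrow> real) \<Rightarrow> real \<Rightarrow> real" where
  "hderiv f r = vector_derivative f (at r within {0..})"

definition C2_half_line :: "(real \<Rightarrow> real) \<Rightarrow> bool" where
  "C2_half_line f \<longleftrightarrow>
     f differentiable_on {0..} \<and> hderiv f differentiable_on {0..} \<and>
     continuous_on {0..} (hderiv (hderiv f))"

definition radial_IVP_solution ::
    "nat \<Rightarrow> real \<Rightarrow> (real \<Rightarrow> real) \<Rightarrow> real \<Rightarrow> (real \<Rightarrow> real) \<Rightarrow> bool" where
  "radial_IVP_solution n p \<psi> \<alpha> u \<longleftrightarrow>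
     C2_half_line u \<and>
     (\<forall>r>0. - (1 / \<psi> r ^ (n - 1)) * hderiv (\<lambda>s. \<psi> s ^ (n - 1) * hderiv u s) r
             = \<bar>u r\<bar> powr (p - 1) * u r) \<and>
     u 0 = \<alpha> \<and> hderiv u 0 = 0"


section \<open>Smooth functions\<close>

definition pderiv_at :: "'n::finite \<Rightarrow> (real ^ 'n \<Rightarrow> real) \<Rightarrow> real ^ 'n \<Rightarrow> real" where
  "pderiv_at i f x = frechet_derivative f (at x) (axis i 1)"

primrec C_k :: "nat \<Rightarrow> (real ^ 'n::finite \<Rightarrow> real) \<Rightarrow> bool" where
  "C_k 0 f \<longleftrightarrow> continuous_on UNIV f"
| "C_k (Suc k) f \<longleftrightarrow> (\<forall>x. f differentiable (at x)) \<and> (\<forall>i. C_k k (pderiv_at i f))"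

definition test_functions :: "(real ^ 'n::finite \<Rightarrow> real) set" where
  "test_functions = {\<phi>. (\<forall>k. C_k k \<phi>) \<and> compact (closure {x. \<phi> x \<noteq> 0})}"


section \<open>The Riemannian model\<close>

text \<open>
  The manifold is \<open>\<real>\<^sup>n\<close> with pole \<open>o = 0\<close>; the polar coordinates of \<open>x \<noteq> 0\<close> are
  \<open>r = norm x\<close>, which is also the geodesic distance from the pole, and \<open>\<Theta> = sgn x = x / norm x\<close>.
  Away from the pole the metric is \<open>dr\<^sup>2 + \<psi>(r)\<^sup>2 d\<Theta>\<^sup>2\<close>, where \<open>d\<Theta>\<^sup>2\<close> is the metric
  of the unit sphere induced by the Euclidean inner product. As \<open>\<psi>(0) = 0\<close> and \<open>\<psi>'(0) = 1\<close>,
  it extends continuously to the pole by the Euclidean inner product.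
\<close>

definition model_metric ::
    "(real \<Rightarrow> real) \<Rightarrow> real ^ 'n::finite \<Rightarrow> real ^ 'n \<Rightarrow> real ^ 'n \<Rightarrow> real" where
  "model_metric \<psi> x v w =
     (if x = 0 then v \<bullet> w
      else (let dr = frechet_derivative norm (at x); d\<Theta> = frechet_derivative sgn (at x)
            in dr v * dr w + (\<psi> (norm x))\<^sup>2 * (d\<Theta> v \<bullet> d\<Theta> w)))"

definition volume_density :: "(real \<Rightarrow> real) \<Rightarrow> real ^ 'n::finite \<Rightarrow> real" where
  "volume_density \<psi> x = sqrt (det (\<chi> i j. model_metric \<psi> x (axis i 1) (axis j 1)))"

definition model_volume :: "(real \<Rightarrow> real) \<Rightarrow> (real ^ 'n::finite) measure" where
  "model_volume \<psi> = density lborel (\<lambda>x. ennreal (volume_density \<psi> x))"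

definition model_grad ::
    "(real \<Rightarrow> real) \<Rightarrow> (real ^ 'n::finite \<Rightarrow> real) \<Rightarrow> real ^ 'n \<Rightarrow> real ^ 'n" where
  "model_grad \<psi> f x =
     (THE w. \<forall>v. model_metric \<psi> x w v = frechet_derivative f (at x) v)"

definition model_div ::
    "(real \<Rightarrow> real) \<Rightarrow> (real ^ 'n::finite \<Rightarrow> real ^ 'n) \<Rightarrow> real ^ 'n \<Rightarrow> real" where
  "model_div \<psi> X x =
     (\<Sum>i\<in>UNIV. pderiv_at i (\<lambda>y. volume_density \<psi> y * X y $ i) x) / volume_density \<psi> x"

definition model_laplacian ::
    "(real \<Rightarrow> real) \<Rightarrow> (real ^ 'n::finite \<Rightarrow> real) \<Rightarrow> real ^ 'n \<Rightarrow> real" where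
  "model_laplacian \<psi> f = model_div \<psi> (model_grad \<psi> f)"


section \<open>The equation and stability\<close>

definition solution_on_model ::
    "real \<Rightarrow> (real \<Rightarrow> real) \<Rightarrow> (real ^ 'n::finite \<Rightarrow> real) \<Rightarrow> bool" where
  "solution_on_model p \<psi> U \<longleftrightarrow>
     C_k 2 U \<and> (\<forall>x. - model_laplacian \<psi> U x = \<bar>U x\<bar> powr (p - 1) * U x)"

text \<open>Only the inequality; it is meant to be applied to solutions of the equation.\<close>

definition stable_on_model ::
    "real \<Rightarrow> (real \<Rightarrow> real) \<Rightarrow> (real ^ 'n::finite \<Rightarrow> real) \<Rightarrow> bool" where
  "stable_on_model p \<psi> U \<longleftrightarrow>
     (\<forall>\<phi>\<in>test_functions.
        (\<integral>x. model_metric \<psi> x (model_grad \<psi> \<phi> x) (model_grad \<psi> \<phi> x) \<partial>model_volume \<psi>)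
        - p * (\<integral>x. \<bar>U x\<bar> powr (p - 1) * (\<phi> x)\<^sup>2 \<partial>model_volume \<psi>) \<ge> 0)"

definition radial_function :: "(real \<Rightarrow> real) \<Rightarrow> real ^ 'n::finite \<Rightarrow> real" where
  "radial_function v x = v (norm x)"

text \<open>
  The stability threshold of a family \<open>U\<close> of functions on the model; the supremum is taken in
  the extended reals, so it may be \<open>\<infinity>\<close>.
\<close>

definition stability_threshold ::
    "real \<Rightarrow> (real \<Rightarrow> real) \<Rightarrow> (real \<Rightarrow> real ^ 'n::finite \<Rightarrow> real) \<Rightarrow> ereal" where
  "stability_threshold p \<psi> U =
     Sup (ereal ` {\<alpha>. \<alpha> \<ge> 0 \<and> (\<forall>\<beta>\<in>{0<..<\<alpha>}. stable_on_model p \<psi> (U \<beta>))})"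

end

theory Submission
  imports Defs
begin

text \<open>
  Let \<open>f(t) = \<bar>t\<bar>\<^bsup>p-1\<^esup> t\<close>, so that \<open>f' = p \<bar>t\<bar>\<^bsup>p-1\<^esup>\<close>. The idea is to test the stability of one
  solution \<open>v\<close> with another solution, or a difference of solutions, cut off at a zero. Let \<open>w\<close> be a
  radial function with \<open>-\<Delta>w = h\<close> and \<open>w(R) = 0\<close>. Continued by 0 outside the ball of radius \<open>R\<close>,
  it is an admissible test function, and integration by parts in the ball gives
  \<open>\<integral>h w = \<integral>\<bar>\<nabla>w\<bar>\<^sup>2 \<ge> p \<integral>\<bar>v\<bar>\<^bsup>p-1\<^esup> w\<^sup>2\<close>. If \<open>h w \<le> p \<bar>v\<bar>\<^bsup>p-1\<^esup> w\<^sup>2\<close> holds pointwise in the ball,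
  then both sides agree everywhere in it (\<open>stability_comparison\<close>).

  For \<open>w = v\<close>, \<open>h = f(v)\<close> and \<open>p > 1\<close> this shows that a stable \<open>v\<close> with a zero vanishes up to that zero;
  then it vanishes identically, by a decreasing energy (\<open>radial_profile_zero_unique\<close>). So
  nontrivial stable radial solutions have a strict sign (\<open>stable_radial_profile_no_zero\<close>). For two
  positive solutions \<open>u\<close> and \<open>v\<close> with \<open>v(0) < u(0)\<close>, \<open>u\<close> stable, and \<open>w = u - v\<close> up to its first zero, strict
  convexity of \<open>f\<close> on \<open>[0,\<infinity>)\<close> gives \<open>(f(u) - f(v)) w < f'(u) w\<^sup>2\<close>, a contradiction
  (\<open>stable_radial_profiles_ordered\<close>). Below the stability threshold all solutions are stable, so the
  ordering follows.

  Two bridges connect this to the geometric definitions. For radial functions, all geometric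
  quantities reduce to the weight \<open>\<psi>\<^bsup>n-1\<^esup>\<close> on the half-line: the volume density is a determinant
  computed in an adapted orthonormal frame, and the integrals are computed in polar coordinates
  (\<open>integral_model_volume_radial\<close>). The truncated functions, which are not smooth, are limits of
  smooth ones of the form \<open>H (x \<bullet> x)\<close>, where \<open>H'\<close> is a polynomial times a flat cutoff
  (\<open>exists_radial_test_function_approximation\<close>).
\<close>

section \<open>Radial test functions\<close>

lemma pderiv_at_eq:
  assumes "(f has_derivative f') (at x)"
  shows "pderiv_at i f x = f' (axis i 1)"
  using frechet_derivative_at[OF assms] by (simp add: pderiv_at_def)

lemma C_k_Suc_imp_C_k: "C_k (Suc k) f \<Longrightarrow> C_k k f"
proof (induction k arbitrary: f)
  case 0
  then show ?case
    by (auto simp: continuous_on_eq_continuous_at differentiable_imp_continuous_within)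
next
  case (Suc k)
  then show ?case by (metis C_k.simps(2))
qed

lemma C_k_const: "C_k k (\<lambda>x :: real ^ 'n::finite. c)"
proof (induction k arbitrary: c)
  case (Suc k)
  have "pderiv_at i (\<lambda>x :: real ^ 'n. c) = (\<lambda>x. 0)" for i
    by (rule ext, subst pderiv_at_eq[OF has_derivative_const]) simp
  then show ?case using Suc by simp
qed simp

lemma C_k_component: "C_k k (\<lambda>x :: real ^ 'n::finite. x $ j)"
proof (cases k)
  case (Suc m)
  have d: "((\<lambda>y :: real ^ 'n. y $ j) has_derivative (\<lambda>v. v $ j)) (at x)" for x
    by (rule bounded_linear_imp_has_derivative[OF bounded_linear_vec_nth])
  have "pderiv_at i (\<lambda>x :: real ^ 'n. x $ j) = (\<lambda>x. axis i 1 $ j)" for i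
    by (rule ext) (rule pderiv_at_eq[OF d])
  then show ?thesis
    using d C_k_const by (auto simp: Suc differentiable_def)
qed (simp add: continuous_intros)

lemma C_k_add: "C_k k f \<Longrightarrow> C_k k g \<Longrightarrow> C_k k (\<lambda>x. f x + g x)"
proof (induction k arbitrary: f g)
  case (Suc k)
  have "pderiv_at i (\<lambda>x. f x + g x) = (\<lambda>x. pderiv_at i f x + pderiv_at i g x)" for i
    using Suc.prems
    by (intro ext, subst pderiv_at_eq[OF has_derivative_add])
       (auto simp: frechet_derivative_works[symmetric] pderiv_at_def)
  then show ?case using Suc by simp
qed (simp add: continuous_intros)

lemma C_k_mult: "C_k k f \<Longrightarrow> C_k k g \<Longrightarrow> C_k k (\<lambda>x. f x * g x)"
proof (induction k arbitrary: f g)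
  case (Suc k)
  have "pderiv_at i (\<lambda>x. f x * g x) = (\<lambda>x. f x * pderiv_at i g x + pderiv_at i f x * g x)" for i
    using Suc.prems
    by (intro ext, subst pderiv_at_eq[OF has_derivative_mult])
       (auto simp: frechet_derivative_works[symmetric] pderiv_at_def)
  moreover have "C_k k f" "C_k k g"
    using Suc.prems by (auto intro: C_k_Suc_imp_C_k)
  ultimately show ?case using Suc by (auto intro!: C_k_add)
qed (simp add: continuous_intros)

lemma has_derivative_comp_inner_self:
  fixes x :: "real ^ 'n::finite"
  assumes "(h has_real_derivative h') (at (x \<bullet> x))"
  shows "((\<lambda>y. h (y \<bullet> y)) has_derivative (\<lambda>v. 2 * h' * (x \<bullet> v))) (at x)"
proof -
  have "((\<lambda>y. y \<bullet> y) has_derivative (\<lambda>v. x \<bullet> v + v \<bullet> x)) (at x)"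
    by (intro derivative_intros)
  from has_derivative_compose[OF this assms[unfolded has_field_derivative_def]]
  show ?thesis by (simp add: inner_commute algebra_simps)
qed

lemma C_k_Suc_comp_inner_self:
  fixes H :: "real \<Rightarrow> real"
  assumes "\<And>s. (H has_real_derivative G s) (at s)"
    and "C_k k (\<lambda>x :: real ^ 'n::finite. G (x \<bullet> x))"
  shows "C_k (Suc k) (\<lambda>x :: real ^ 'n. H (x \<bullet> x))"
proof -
  have d: "((\<lambda>y. H (y \<bullet> y)) has_derivative (\<lambda>v. 2 * G (x \<bullet> x) * (x \<bullet> v))) (at x)" for x :: "real ^ 'n"
    by (rule has_derivative_comp_inner_self[OF assms(1)])
  have "pderiv_at i (\<lambda>x :: real ^ 'n. H (x \<bullet> x)) = (\<lambda>x. 2 * (G (x \<bullet> x) * x $ i))" for i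
    by (rule ext, subst pderiv_at_eq[OF d]) (simp add: inner_axis)
  moreover have "C_k k (\<lambda>x :: real ^ 'n. 2 * (G (x \<bullet> x) * x $ i))" for i
    by (intro C_k_mult C_k_const C_k_component assms(2))
  ultimately show ?thesis using d by (auto simp: differentiable_def)
qed

text \<open>
  Radial test functions are built as \<open>\<lambda>x. h (x \<bullet> x)\<close> instead of \<open>\<lambda>x. h (norm x)\<close>, since the
  former is as smooth as \<open>h\<close>, also at the pole. Each partial derivative brings in one factor \<open>h'\<close>
  of the same kind, so a class of functions closed under differentiation passes to \<^const>\<open>C_k\<close>.
\<close>
lemma C_k_comp_inner_self:
  fixes S :: "(real \<Rightarrow> real) set"
  assumes closed: "\<And>h. h \<in> S \<Longrightarrow> \<exists>h'\<in>S. \<forall>s. (h has_real_derivative h' s) (at s)"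
    and "h \<in> S"
  shows "C_k k (\<lambda>x :: real ^ 'n::finite. h (x \<bullet> x))"
  using assms(2)
proof (induction k arbitrary: h)
  case 0
  then obtain h' where "\<And>s. (h has_real_derivative h' s) (at s)" using closed by blast
  then have "continuous_on UNIV h"
    by (meson DERIV_isCont continuous_at_imp_continuous_on)
  then have "continuous_on UNIV (\<lambda>x :: real ^ 'n. h (x \<bullet> x))"
    by (rule continuous_on_compose2) (auto intro: continuous_intros)
  then show ?case by simp
next
  case (Suc k)
  then show ?case using closed[OF Suc.prems] C_k_Suc_comp_inner_self by blast
qed

text \<open>
  The classical flat functions \<open>q (1/t) exp (-1/t)\<close>, extended by 0. Letting the polynomial \<open>q\<close> vary
  makes the class closed under differentiation; \<open>q = 1\<close> gives the cutoff used below.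
\<close>
definition flat_exp :: "(real \<Rightarrow> real) \<Rightarrow> real \<Rightarrow> real" where
  "flat_exp q t = (if t > 0 then q (1 / t) * exp (- (1 / t)) else 0)"

lemma real_polynomial_function_times_exp_tendsto_0:
  assumes "real_polynomial_function q"
  shows "((\<lambda>x. q x * exp (- x)) \<longlongrightarrow> 0) at_top"
proof -
  obtain a m where q: "q = (\<lambda>x. \<Sum>i\<le>m. a i * x ^ i)"
    using assms by (auto simp: real_polynomial_function_iff_sum)
  have "((\<lambda>x::real. \<Sum>i\<le>m. a i * (x ^ i / exp x)) \<longlongrightarrow> (\<Sum>i\<le>m. a i * 0)) at_top"
    by (intro tendsto_intros tendsto_power_div_exp_0)
  then show ?thesis
    by (simp add: q exp_minus sum_distrib_right divide_inverse mult.assoc)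
qed

lemma flat_exp_has_real_derivative:
  assumes q: "real_polynomial_function q" and q': "\<And>x. (q has_real_derivative q' x) (at x)"
  shows "(flat_exp q has_real_derivative flat_exp (\<lambda>x. x\<^sup>2 * (q x - q' x)) t) (at t)"
proof -
  consider "t > 0" | "t < 0" | "t = 0" by linarith
  then show ?thesis
  proof cases
    case 1
    have "((\<lambda>t. q (1 / t)) has_real_derivative q' (1 / t) * (- (1 / t\<^sup>2))) (at t)"
      by (rule DERIV_chain2[OF q']) (use 1 in \<open>auto intro!: derivative_eq_intros simp: power2_eq_square\<close>)
    then have "((\<lambda>t. q (1 / t) * exp (- (1 / t))) has_real_derivative
        (1 / t)\<^sup>2 * (q (1 / t) - q' (1 / t)) * exp (- (1 / t))) (at t)"
      using 1 by (auto intro!: derivative_eq_intros simp: field_simps power2_eq_square)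
    then have "(flat_exp q has_real_derivative
        (1 / t)\<^sup>2 * (q (1 / t) - q' (1 / t)) * exp (- (1 / t))) (at t)"
      by (rule DERIV_cong_ev[OF refl _ refl, THEN iffD1, rotated])
         (use eventually_nhds_in_open[of "{0<..}" t] 1 in \<open>auto elim!: eventually_mono simp: flat_exp_def\<close>)
    then show ?thesis using 1 by (simp add: flat_exp_def)
  next
    case 2
    have "((\<lambda>t. 0) has_real_derivative 0) (at t)" by simp
    then have "(flat_exp q has_real_derivative 0) (at t)"
      by (rule DERIV_cong_ev[OF refl _ refl, THEN iffD1, rotated])
         (use eventually_nhds_in_open[of "{..<0}" t] 2 in \<open>auto elim!: eventually_mono simp: flat_exp_def\<close>)
    then show ?thesis using 2 by (simp add: flat_exp_def)
  next
    case 3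
    have "real_polynomial_function (\<lambda>x. x * q x)"
      using real_polynomial_function.intros(4)[OF real_polynomial_function.intros(1)[OF bounded_linear_ident] q]
      by simp
    from real_polynomial_function_times_exp_tendsto_0[OF this]
    have "((\<lambda>x. inverse x * q (inverse x) * exp (- inverse x)) \<longlongrightarrow> 0) (at_right 0)"
      by (rule filterlim_compose[OF _ filterlim_inverse_at_top_right])
    then have "((\<lambda>y. flat_exp q y / y) \<longlongrightarrow> 0) (at_right 0)"
    proof (rule Lim_transform_eventually)
      show "\<forall>\<^sub>F x in at_right 0. inverse x * q (inverse x) * exp (- inverse x) = flat_exp q x / x"
        using eventually_at_right_less[of "0::real"]
        by (rule eventually_mono) (simp add: flat_exp_def field_simps)
    qed
    moreover have "((\<lambda>y. flat_exp q y / y) \<longlongrightarrow> 0) (at_left 0)"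
      by (rule tendsto_eventually)
         (auto simp: flat_exp_def eventually_at_filter)
    ultimately have "((\<lambda>y. flat_exp q y / y) \<longlongrightarrow> 0) (at 0)"
      by (simp add: filterlim_split_at)
    then show ?thesis using 3 by (simp add: has_field_derivative_iff flat_exp_def)
  qed
qed

lemma isCont_flat_exp: "isCont (flat_exp (\<lambda>_. 1)) t"
  by (rule DERIV_isCont[OF flat_exp_has_real_derivative[where q' = "\<lambda>_. 0"]]) auto

lemma C_k_flat_exp_comp:
  "C_k k (\<lambda>x :: real ^ 'n::finite. flat_exp (\<lambda>_. 1) (a * (c - x \<bullet> x)))"
proof (rule C_k_comp_inner_self)
  let ?S = "{(\<lambda>s. flat_exp q (a * (c - s))) | q. real_polynomial_function q}"
  show "(\<lambda>s. flat_exp (\<lambda>_. 1) (a * (c - s))) \<in> ?S"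
    using real_polynomial_function.intros(2) by blast
  show "\<exists>h'\<in>?S. \<forall>s. (h has_real_derivative h' s) (at s)" if "h \<in> ?S" for h
  proof -
    from that obtain q where q: "real_polynomial_function q" and h: "h = (\<lambda>s. flat_exp q (a * (c - s)))"
      by blast
    obtain q' where q': "real_polynomial_function q'" "\<And>x. (q has_real_derivative q' x) (at x)"
      using has_real_derivative_polynomial_function[OF q] by blast
    let ?r = "\<lambda>x. - a * (x\<^sup>2 * (q x - q' x))"
    have "real_polynomial_function ?r"
      unfolding power2_eq_square
      by (intro real_polynomial_function.intros(4) real_polynomial_function_diff q q'
          real_polynomial_function.intros(2) real_polynomial_function.intros(1) bounded_linear_ident)
    moreover have "(h has_real_derivative flat_exp ?r (a * (c - s))) (at s)" for s
    proof -
      have "((\<lambda>s. a * (c - s)) has_real_derivative - a) (at s)"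
        by (auto intro!: derivative_eq_intros)
      from DERIV_chain2[OF flat_exp_has_real_derivative[OF q q'(2)] this]
      show ?thesis by (simp add: h flat_exp_def algebra_simps split: if_splits)
    qed
    ultimately show ?thesis
      by (intro bexI[of _ "\<lambda>s. flat_exp ?r (a * (c - s))"]) auto
  qed
qed

lemma C_k_polynomial_comp:
  assumes "real_polynomial_function q"
  shows "C_k k (\<lambda>x :: real ^ 'n::finite. q (x \<bullet> x))"
  by (rule C_k_comp_inner_self[of "Collect real_polynomial_function"])
     (use assms has_real_derivative_polynomial_function in auto)

text \<open>
  Prescribing the derivative, and not the function, makes compact support free: the primitive that
  vanishes at \<open>c\<close> vanishes on the whole of \<open>[c,\<infinity>)\<close>, because the flat factor does. It also gives
  control of the gradient when the polynomial \<open>q\<close> approximates a given derivative.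
\<close>
lemma exists_radial_test_function:
  fixes q :: "real \<Rightarrow> real" and a c :: real
  assumes q: "real_polynomial_function q" and a: "a > 0"
  defines "G \<equiv> \<lambda>s. q s * flat_exp (\<lambda>_. 1) (a * (c - s))"
  obtains H where "\<And>s. (H has_real_derivative G s) (at s)" "\<And>s. s \<ge> c \<Longrightarrow> H s = 0"
    "(\<lambda>x :: real ^ 'n::finite. H (x \<bullet> x)) \<in> test_functions"
proof -
  have "isCont (\<lambda>s. flat_exp (\<lambda>_. 1) (a * (c - s))) s" for s
    by (rule isCont_o2[OF _ isCont_flat_exp]) (intro continuous_intros)
  then have contG: "isCont G s" for s
    unfolding G_def using continuous_real_polymonial_function[OF q] by (intro continuous_mult)
  obtain F where F: "\<And>s. (F has_real_derivative G s) (at s)"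
    using einterval_antiderivative[of "-\<infinity>" "\<infinity>" G] contG
    by (auto simp: has_real_derivative_iff_has_vector_derivative)
  (* The primitive is normalised at c, the end of the support of G. *)
  define H where "H = (\<lambda>s. F s - F c)"
  have H: "(H has_real_derivative G s) (at s)" for s
    using F[of s] unfolding H_def by (auto intro!: derivative_eq_intros)
  have H0: "H s = 0" if "s \<ge> c" for s
  proof (cases "s = c")
    case False
    with that have "c < s" by simp
    moreover have "continuous_on {c..s} F"
      using F by (meson DERIV_isCont continuous_at_imp_continuous_on)
    moreover have "(F has_real_derivative 0) (at t)" if "c < t" for t
    proof -
      have "G t = 0"
        using that a by (simp add: G_def flat_exp_def zero_less_mult_iff)
      then show ?thesis using F[of t] by simp
    qed
    ultimately have "F s = F c"
      by (intro DERIV_isconst_end) auto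
    then show ?thesis by (simp add: H_def)
  qed (simp add: H_def)
  have "C_k k (\<lambda>x :: real ^ 'n. H (x \<bullet> x))" for k
  proof (rule C_k_Suc_imp_C_k, rule C_k_Suc_comp_inner_self[OF H])
    show "C_k k (\<lambda>x :: real ^ 'n. G (x \<bullet> x))"
      unfolding G_def by (intro C_k_mult C_k_polynomial_comp C_k_flat_exp_comp q)
  qed
  moreover have "compact (closure {x :: real ^ 'n. H (x \<bullet> x) \<noteq> 0})"
  proof -
    have "x \<in> cball 0 (sqrt c)" if "H (x \<bullet> x) \<noteq> 0" for x :: "real ^ 'n"
      using H0[of "x \<bullet> x"] that by (force simp: norm_eq_sqrt_inner)
    then have "{x :: real ^ 'n. H (x \<bullet> x) \<noteq> 0} \<subseteq> cball 0 (sqrt c)"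
      by blast
    then show ?thesis
      by (meson bounded_cball bounded_subset compact_closure)
  qed
  ultimately show ?thesis using that H H0 by (auto simp: test_functions_def)
qed

section \<open>The metric, the volume density and radial gradients\<close>

lemma has_derivative_norm_at:
  fixes x :: "'a::real_inner"
  assumes "x \<noteq> 0"
  shows "(norm has_derivative (\<lambda>v. x \<bullet> v / norm x)) (at x)"
  using has_derivative_norm[OF assms]
  by (simp add: sgn_div_norm inner_commute divide_inverse mult.commute)

lemma has_derivative_sgn_at:
  fixes x :: "'a::real_inner"
  assumes "x \<noteq> 0"
  shows "(sgn has_derivative (\<lambda>v. (1 / norm x) *\<^sub>R v - (x \<bullet> v / norm x ^ 3) *\<^sub>R x)) (at x)"
proof -
  have "((\<lambda>y. inverse (norm y)) has_derivative
          (\<lambda>v. - (inverse (norm x) * (x \<bullet> v / norm x) * inverse (norm x)))) (at x)"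
    using assms by (intro Deriv.has_derivative_inverse has_derivative_norm_at) auto
  from has_derivative_scaleR[OF this has_derivative_ident]
  show ?thesis
    using assms
    by (simp add: sgn_div_norm[abs_def] field_simps power3_eq_cube)
qed

text \<open>
  The projection of a vector on the radial direction is measured by the Euclidean metric, and its
  projection on the tangent space of the sphere is rescaled by \<open>\<psi>(r)/r\<close>.
\<close>
lemma model_metric_eq:
  assumes "x \<noteq> 0"
  shows "model_metric \<psi> x v w = (x \<bullet> v) * (x \<bullet> w) / (norm x)\<^sup>2
    + (\<psi> (norm x) / norm x)\<^sup>2 * (v \<bullet> w - (x \<bullet> v) * (x \<bullet> w) / (norm x)\<^sup>2)"
proof -
  define N where "N = norm x"
  have N: "N > 0" "x \<bullet> x = N * N"
    using assms by (simp_all add: N_def power2_norm_eq_inner[symmetric] power2_eq_square)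
  have "((1 / N) *\<^sub>R v - (x \<bullet> v / N ^ 3) *\<^sub>R x) \<bullet> ((1 / N) *\<^sub>R w - (x \<bullet> w / N ^ 3) *\<^sub>R x)
      = (v \<bullet> w - (x \<bullet> v) * (x \<bullet> w) / N\<^sup>2) / N\<^sup>2"
    using N by (simp add: inner_diff_left inner_diff_right inner_commute[of v x]
        divide_simps power2_eq_square power3_eq_cube)
  then show ?thesis
    using assms N(1)
    by (simp add: model_metric_def frechet_derivative_at[OF has_derivative_norm_at, symmetric]
        frechet_derivative_at[OF has_derivative_sgn_at, symmetric] N_def[symmetric] power_divide
        power2_eq_square)
qed

text \<open>
  The volume density of the model in Euclidean coordinates, as a function of the distance from the
  pole; the value 1 at the pole is the limit, because \<open>\<psi>'(0) = 1\<close>.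
\<close>
definition radial_density :: "nat \<Rightarrow> (real \<Rightarrow> real) \<Rightarrow> real \<Rightarrow> real" where
  "radial_density n \<psi> r = (if r = 0 then 1 else (\<psi> r / r) ^ (n - 1))"

text \<open>
  In an orthonormal frame with one radial vector the metric is diagonal, with entry 1 in the radial
  direction and \<open>(\<psi>(r)/r)\<^sup>2\<close> in the other \<open>n - 1\<close> directions.
\<close>
lemma volume_density_eq:
  fixes x :: "real ^ 'n::finite"
  assumes pos: "\<And>r. r > 0 \<Longrightarrow> \<psi> r > 0"
  shows "volume_density \<psi> x = radial_density CARD('n) \<psi> (norm x)"
proof (cases "x = 0")
  case True
  have "(\<chi> i j. model_metric \<psi> x (axis i 1) (axis j 1)) = (mat 1 :: real ^ 'n ^ 'n)"
    using True by (auto simp: vec_eq_iff model_metric_def mat_def inner_axis_axis)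
  then show ?thesis using True by (simp add: volume_density_def radial_density_def)
next
  case False
  define e where "e = x /\<^sub>R norm x"
  define a where "a = (\<psi> (norm x) / norm x)\<^sup>2"
  have apos: "\<psi> (norm x) / norm x > 0" using False pos by simp
  have "norm e = 1" using False by (simp add: e_def)
  fix k :: 'n
  (* The k-th column of Q is the radial direction, so Q diagonalises the metric. *)
  obtain Q where Q: "orthogonal_matrix Q" "Q *v axis k 1 = e"
    using orthogonal_matrix_exists_basis[OF \<open>norm e = 1\<close>] by metis
  have Qk: "Q $ i $ k = e $ i" for i
    using Q(2) by (metis column_def matrix_vector_mul_component matrix_vector_mult_basis vec_lambda_beta)
  define D :: "real ^ 'n ^ 'n" where "D = (\<chi> i j. if i = j then (if i = k then 1 else a) else 0)"
  have "(\<chi> i j. model_metric \<psi> x (axis i 1) (axis j 1)) = Q ** (D ** transpose Q)"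
  proof -
    have QQ: "(\<Sum>l\<in>UNIV. Q $ i $ l * Q $ j $ l) = (if i = j then 1 else 0)" for i j
    proof -
      have "(Q ** transpose Q) $ i $ j = (mat 1 :: real ^ 'n ^ 'n) $ i $ j"
        using Q(1) by (simp add: orthogonal_matrix_def)
      then show ?thesis by (simp add: matrix_matrix_mult_def transpose_def mat_def)
    qed
    have "(D ** transpose Q) $ l $ j = (if l = k then 1 else a) * Q $ j $ l" for l j
      by (simp add: matrix_matrix_mult_def D_def transpose_def if_distrib[of "\<lambda>z. z * _"] cong: if_cong)
    then have "(Q ** (D ** transpose Q)) $ i $ j =
        (\<Sum>l\<in>UNIV. a * (Q $ i $ l * Q $ j $ l) + (if l = k then (1 - a) * (Q $ i $ k * Q $ j $ k) else 0))" for i j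
      unfolding matrix_matrix_mult_def[of Q] by (auto intro!: sum.cong simp: algebra_simps)
    then have "(Q ** (D ** transpose Q)) $ i $ j =
        a * (if i = j then 1 else 0) + (1 - a) * (e $ i * e $ j)" for i j
      by (simp add: sum.distrib sum_distrib_left[symmetric] QQ Qk)
    moreover have "model_metric \<psi> x (axis i 1) (axis j 1) =
        a * (if i = j then 1 else 0) + (1 - a) * (e $ i * e $ j)" for i j
    proof -
      have "e $ i * e $ j = x $ i * x $ j / (norm x)\<^sup>2"
        by (simp add: e_def power2_eq_square divide_inverse mult_ac)
      moreover have "axis i (1::real) \<bullet> axis j 1 = (if i = j then 1 else 0)"
        by (simp add: inner_axis_axis)
      ultimately show ?thesis
        unfolding model_metric_eq[OF False] a_def[symmetric] inner_axis
        by (simp add: algebra_simps diff_divide_distrib)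
    qed
    ultimately show ?thesis by (simp add: vec_eq_iff)
  qed
  then have "det (\<chi> i j. model_metric \<psi> x (axis i 1) (axis j 1)) = (det Q)\<^sup>2 * det D"
    by (simp add: det_mul power2_eq_square)
  also have "(det Q)\<^sup>2 = 1" using det_orthogonal_matrix[OF Q(1)] by auto
  also have "det D = (\<Prod>i\<in>UNIV. if i = k then 1 else a)"
    by (subst det_diagonal) (auto simp: D_def)
  also have "\<dots> = a ^ (CARD('n) - 1)"
    by (simp add: prod.If_cases Compl_eq_Diff_UNIV card_Diff_singleton)
  also have "\<dots> = ((\<psi> (norm x) / norm x) ^ (CARD('n) - 1))\<^sup>2"
    by (simp add: a_def power_mult[symmetric] mult.commute)
  finally show ?thesis
    using False apos by (simp add: volume_density_def radial_density_def)
qed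

text \<open>
  The description that defines the gradient has at most one solution, as the metric is positive
  definite; this is where \<open>\<psi> > 0\<close> enters.
\<close>
lemma model_grad_eqI:
  assumes pos: "\<And>r. r > 0 \<Longrightarrow> \<psi> r > 0"
    and w: "\<And>v. model_metric \<psi> x w v = frechet_derivative f (at x) v"
  shows "model_grad \<psi> f x = w"
  unfolding model_grad_def
proof (rule the_equality)
  fix z assume z: "\<forall>v. model_metric \<psi> x z v = frechet_derivative f (at x) v"
  show "z = w"
  proof (cases "x = 0")
    case True
    then have "z \<bullet> v = w \<bullet> v" for v
      using z w by (simp add: model_metric_def)
    then show ?thesis by (metis vector_eq_rdot)
  next
    case False
    define d where "d = z - w"
    let ?a = "(\<psi> (norm x) / norm x)\<^sup>2"
    have apos: "?a > 0" using False pos[of "norm x"] by simp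
    have "model_metric \<psi> x z v - model_metric \<psi> x w v = 0" for v using z w by simp
    then have g: "(x \<bullet> d) * (x \<bullet> v) / (norm x)\<^sup>2
        + ?a * (d \<bullet> v - (x \<bullet> d) * (x \<bullet> v) / (norm x)\<^sup>2) = 0" for v
      using False by (simp add: model_metric_eq d_def inner_diff_left inner_diff_right algebra_simps diff_divide_distrib)
    have "x \<bullet> d = 0"
      using g[of x] False by (simp add: power2_norm_eq_inner inner_commute)
    then have "d \<bullet> d = 0" using g[of d] apos by simp
    then show ?thesis by (simp add: d_def)
  qed
qed (use w in blast)

lemma model_metric_radial_direction: "model_metric \<psi> x (c *\<^sub>R x) v = c * (x \<bullet> v)"
proof (cases "x = 0")
  case True
  then show ?thesis by (simp add: model_metric_def)
next
  case False
  then show ?thesis by (simp add: model_metric_eq power2_norm_eq_inner)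
qed

lemma model_grad_radial:
  assumes pos: "\<And>r. r > 0 \<Longrightarrow> \<psi> r > 0"
    and "x \<noteq> 0" "(v has_real_derivative d) (at (norm x))"
  shows "model_grad \<psi> (radial_function v) x = (d / norm x) *\<^sub>R x"
proof (rule model_grad_eqI[OF pos])
  have "(radial_function v has_derivative (\<lambda>h. d * (x \<bullet> h / norm x))) (at x)"
    using has_derivative_compose[OF has_derivative_norm_at[OF assms(2)]
        assms(3)[unfolded has_field_derivative_def]]
    by (simp add: radial_function_def[abs_def])
  from frechet_derivative_at[OF this, symmetric]
  show "model_metric \<psi> x ((d / norm x) *\<^sub>R x) h = frechet_derivative (radial_function v) (at x) h" for h
    by (simp add: model_metric_radial_direction)
qed

lemma model_metric_grad_comp_inner_self:
  fixes x :: "real ^ 'n::finite"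
  assumes pos: "\<And>r. r > 0 \<Longrightarrow> \<psi> r > 0"
    and H: "(H has_real_derivative d) (at (x \<bullet> x))"
  defines "g \<equiv> model_grad \<psi> (\<lambda>y. H (y \<bullet> y)) x"
  shows "model_metric \<psi> x g g = (2 * norm x * d)\<^sup>2"
proof -
  have "frechet_derivative (\<lambda>y. H (y \<bullet> y)) (at x) v = 2 * d * (x \<bullet> v)" for v
    by (simp add: frechet_derivative_at[OF has_derivative_comp_inner_self[OF H], symmetric])
  then have "g = (2 * d) *\<^sub>R x"
    unfolding g_def
    by (intro model_grad_eqI pos) (auto simp: model_metric_radial_direction)
  then show ?thesis
    by (simp add: model_metric_radial_direction power_mult_distrib power2_norm_eq_inner)
       (simp add: power2_eq_square)
qed

section \<open>Integration of radial functions\<close>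

text \<open>
  This is integration in polar coordinates for radial functions. Both measures give \<open>(-\<infinity>,r]\<close> the
  volume \<open>\<omega> r\<^sup>n\<close> of the ball of radius \<open>r\<close>, and these half-lines generate the Borel sets.
\<close>
lemma distr_norm_lborel:
  "distr (lborel :: 'a::euclidean_space measure) borel norm =
    density lborel (\<lambda>r. ennreal (indicator {0..} r * (unit_ball_vol DIM('a) * (DIM('a) * r ^ (DIM('a) - 1)))))"
    (is "?M = ?N")
proof (rule measure_eqI_generator_eq[where E = "range atMost" and \<Omega> = UNIV and A = "\<lambda>i. {..real i}"])
  show "Int_stable (range (atMost :: real \<Rightarrow> _))"
    by (auto simp: Int_stable_def)
  show "sets ?M = sigma_sets UNIV (range atMost)" "sets ?N = sigma_sets UNIV (range atMost)"
    by (simp_all add: borel_eq_atMost)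
  have M: "emeasure ?M {..r} = ennreal (if r \<ge> 0 then unit_ball_vol DIM('a) * r ^ DIM('a) else 0)" for r
  proof -
    have "emeasure ?M {..r} = emeasure (lborel :: 'a measure) (norm -` {..r} \<inter> space lborel)"
      by (rule emeasure_distr) auto
    also have "norm -` {..r} \<inter> space (lborel :: 'a measure) = cball 0 r"
      by auto
    also have "emeasure lborel \<dots> = ennreal (if r \<ge> 0 then unit_ball_vol DIM('a) * r ^ DIM('a) else 0)"
      by (simp add: emeasure_cball)
    finally show ?thesis .
  qed
  show "emeasure ?M {..real i} \<noteq> \<infinity>" for i by (simp add: M)
  fix X assume "X \<in> range (atMost :: real \<Rightarrow> _)"
  then obtain r :: real where X: "X = {..r}" by blast
  have "emeasure ?N X = (\<integral>\<^sup>+x. ennreal (unit_ball_vol DIM('a) * (DIM('a) * x ^ (DIM('a) - 1))) * indicator {0..r} x \<partial>lborel)"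
    unfolding X by (subst emeasure_density) (auto intro!: nn_integral_cong split: split_indicator)
  also have "\<dots> = ennreal (if r \<ge> 0 then unit_ball_vol DIM('a) * r ^ DIM('a) else 0)"
  proof (cases "r \<ge> 0")
    case True
    have "(\<integral>\<^sup>+x. ennreal (unit_ball_vol DIM('a) * (DIM('a) * x ^ (DIM('a) - 1))) * indicator {0..r} x \<partial>lborel)
       = ennreal (unit_ball_vol DIM('a) * r ^ DIM('a) - unit_ball_vol DIM('a) * 0 ^ DIM('a))"
      by (rule nn_integral_FTC_Icc[OF _ _ _ True]) (auto intro!: derivative_eq_intros)
    then show ?thesis using True by (simp add: zero_power)
  qed simp
  finally show "emeasure ?M X = emeasure ?N X" by (simp add: X M)
qed (auto intro: real_arch_simple)

lemma lebesgue_integral_radial: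
  fixes f :: "real \<Rightarrow> real"
  assumes f: "continuous_on {0..R} f" "\<And>r. r > R \<Longrightarrow> f r = 0"
  shows "(\<integral>x. f (norm x) \<partial>(lborel :: 'a::euclidean_space measure)) =
    DIM('a) * unit_ball_vol DIM('a) * integral {0..R} (\<lambda>r. r ^ (DIM('a) - 1) * f r)"
proof -
  define g where "g = (\<lambda>r. indicator {0..R} r *\<^sub>R f r)"
  have [measurable]: "g \<in> borel_measurable borel"
    unfolding g_def using f(1) by (intro borel_measurable_continuous_on_indicator) auto
  have "(\<integral>x. f (norm x) \<partial>(lborel :: 'a measure)) = (\<integral>x. g (norm x) \<partial>(lborel :: 'a measure))"
    using f(2) by (intro Bochner_Integration.integral_cong) (auto simp: g_def split: split_indicator)
  also have "\<dots> = (\<integral>r. g r \<partial>distr (lborel :: 'a measure) borel norm)"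
    by (rule integral_distr[symmetric]) auto
  also have "\<dots> = (\<integral>r. indicator {0..} r * (unit_ball_vol DIM('a) * (DIM('a) * r ^ (DIM('a) - 1))) * g r \<partial>lborel)"
    unfolding distr_norm_lborel
    by (subst integral_density) (auto split: split_indicator)
  also have "\<dots> = (\<integral>r. (DIM('a) * unit_ball_vol DIM('a)) * (indicator {0..R} r *\<^sub>R (r ^ (DIM('a) - 1) * f r)) \<partial>lborel)"
    by (intro Bochner_Integration.integral_cong) (auto simp: g_def split: split_indicator)
  also have "\<dots> = (DIM('a) * unit_ball_vol DIM('a)) * (LINT r:{0..R}|lborel. r ^ (DIM('a) - 1) * f r)"
    by (simp add: set_lebesgue_integral_def)
  also have "(LINT r:{0..R}|lborel. r ^ (DIM('a) - 1) * f r) = integral {0..R} (\<lambda>r. r ^ (DIM('a) - 1) * f r)"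
    by (intro set_borel_integral_eq_integral borel_integrable_atLeastAtMost' continuous_intros f)
  finally show ?thesis .
qed

lemma continuous_on_comp_norm:
  assumes "continuous_on {0..} f"
  shows "continuous_on UNIV (\<lambda>x :: 'a::real_normed_vector. f (norm x))"
  by (rule continuous_on_compose2[OF assms]) (auto intro: continuous_intros)

text \<open>
  This is used twice: for \<open>\<psi>(r)/r\<close>, which determines the volume density, and for \<open>w'(r)/r\<close>, which
  has to be continuous for \<open>w\<close> to be a \<open>C\<^sup>1\<close> function of \<open>r\<^sup>2\<close>.
\<close>
lemma continuous_on_difference_quotient_at_0:
  fixes f :: "real \<Rightarrow> real"
  assumes "f 0 = 0" "continuous_on {0..} f" "(f has_real_derivative d) (at 0 within {0..})"
  shows "continuous_on {0..} (\<lambda>r. if r = 0 then d else f r / r)" (is "continuous_on _ ?q")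
  unfolding continuous_on_eq_continuous_within
proof
  fix r :: real assume r: "r \<in> {0..}"
  show "continuous (at r within {0..}) ?q"
  proof (cases "r = 0")
    case True
    have "((\<lambda>y. f y / y) \<longlongrightarrow> d) (at 0 within {0..})"
      using assms(1,3) by (simp add: has_field_derivative_iff)
    then have "(?q \<longlongrightarrow> d) (at 0 within {0..})"
      by (rule Lim_transform_eventually) (auto simp: eventually_at_filter)
    then show ?thesis using True by (simp add: continuous_within)
  next
    case False
    have "continuous (at r within {0..}) (\<lambda>y. f y / y)"
      using False assms(2) r
      by (intro continuous_intros) (auto simp: continuous_on_eq_continuous_within)
    then show ?thesis
    proof (rule continuous_transform_within)
      show "0 < r" "r \<in> {0..}" using False r by auto
    qed (auto simp: dist_real_def)
  qed
qed

lemma continuous_on_radial_density: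
  assumes "\<psi> 0 = 0" "continuous_on {0..} \<psi>" "(\<psi> has_real_derivative 1) (at 0 within {0..})"
  shows "continuous_on {0..} (radial_density n \<psi>)"
proof -
  have "radial_density n \<psi> = (\<lambda>r. (if r = 0 then 1 else \<psi> r / r) ^ (n - 1))"
    by (auto simp: radial_density_def)
  then show ?thesis
    by (simp only:) (intro continuous_on_power continuous_on_difference_quotient_at_0 assms)
qed

text \<open>
  The powers of \<open>r\<close> in the volume density and in the polar coordinates cancel, which leaves the
  weight \<open>\<psi>\<^bsup>n-1\<^esup>\<close>.
\<close>
lemma integral_model_volume_radial:
  fixes f :: "real \<Rightarrow> real"
  assumes pos: "\<And>r. r > 0 \<Longrightarrow> \<psi> r > 0"
    and psi: "\<psi> 0 = 0" "continuous_on {0..} \<psi>" "(\<psi> has_real_derivative 1) (at 0 within {0..})"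
    and f: "continuous_on {0..} f" "\<And>r. r > R \<Longrightarrow> f r = 0"
  shows "(\<integral>x. f (norm x) \<partial>model_volume \<psi> :: (real ^ 'n::finite) measure) =
    CARD('n) * unit_ball_vol CARD('n) * integral {0..R} (\<lambda>r. \<psi> r ^ (CARD('n) - 1) * f r)"
proof -
  let ?\<rho> = "radial_density CARD('n) \<psi>"
  note \<rho>_cont = continuous_on_radial_density[OF psi]
  have \<rho>_nonneg: "?\<rho> (norm x) \<ge> 0" for x :: "real ^ 'n"
    using pos[of "norm x"] by (auto simp: radial_density_def)
  have vd: "volume_density \<psi> x = ?\<rho> (norm x)" for x :: "real ^ 'n"
    by (rule volume_density_eq[OF pos])
  have "(\<integral>x. f (norm x) \<partial>(model_volume \<psi> :: (real ^ 'n) measure)) =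
      (\<integral>x. ?\<rho> (norm x) *\<^sub>R f (norm x) \<partial>(lborel :: (real ^ 'n) measure))"
    unfolding model_volume_def vd
    using \<rho>_nonneg continuous_on_comp_norm[OF f(1)] continuous_on_comp_norm[OF \<rho>_cont]
    by (intro integral_density) (auto intro: borel_measurable_continuous_onI)
  also have "\<dots> = (\<integral>x. ?\<rho> (norm x) * f (norm x) \<partial>(lborel :: (real ^ 'n) measure))"
    by simp
  also have "\<dots> = CARD('n) * unit_ball_vol CARD('n) *
      integral {0..R} (\<lambda>r. r ^ (CARD('n) - 1) * (?\<rho> r * f r))"
    by (subst lebesgue_integral_radial[where f = "\<lambda>r. ?\<rho> r * f r" and R = R])
       (auto intro!: continuous_intros continuous_on_subset[OF \<rho>_cont] continuous_on_subset[OF f(1)] simp: f(2))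
  also have "integral {0..R} (\<lambda>r. r ^ (CARD('n) - 1) * (?\<rho> r * f r)) =
      integral {0..R} (\<lambda>r. \<psi> r ^ (CARD('n) - 1) * f r)"
    by (intro Henstock_Kurzweil_Integration.integral_cong)
       (auto simp: radial_density_def psi(1) power_divide)
  finally show ?thesis .
qed

section \<open>The stability inequality for truncated radial functions\<close>

lemma stability_inequality_comp_inner_self:
  assumes pos: "\<And>r. r > 0 \<Longrightarrow> \<psi> r > 0"
    and psi: "\<psi> 0 = 0" "continuous_on {0..} \<psi>" "(\<psi> has_real_derivative 1) (at 0 within {0..})"
    and p: "p > 1" and v: "continuous_on {0..} v"
    and stable: "stable_on_model p \<psi> (radial_function v :: real ^ 'n::finite \<Rightarrow> real)"
    and H: "\<And>s. (H has_real_derivative G s) (at s)" "(\<lambda>x :: real ^ 'n. H (x \<bullet> x)) \<in> test_functions"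
    and G: "continuous_on UNIV G"
    and zero: "\<And>s. s > R\<^sup>2 \<Longrightarrow> H s = 0" "\<And>s. s > R\<^sup>2 \<Longrightarrow> G s = 0"
    and R: "R \<ge> 0"
  shows "integral {0..R} (\<lambda>r. \<psi> r ^ (CARD('n) - 1) *
    ((2 * r * G (r\<^sup>2))\<^sup>2 - p * (\<bar>v r\<bar> powr (p - 1) * (H (r\<^sup>2))\<^sup>2))) \<ge> 0"
proof -
  let ?\<phi> = "\<lambda>x :: real ^ 'n. H (x \<bullet> x)"
  let ?K = "CARD('n) * unit_ball_vol CARD('n)"
  let ?I = "\<lambda>f. integral {0..R} (\<lambda>r. \<psi> r ^ (CARD('n) - 1) * f r)"
  let ?f = "\<lambda>r. (2 * r * G (r\<^sup>2))\<^sup>2" and ?g = "\<lambda>r. \<bar>v r\<bar> powr (p - 1) * (H (r\<^sup>2))\<^sup>2"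
  have Hc: "continuous_on UNIV H"
    using H(1) by (meson DERIV_isCont continuous_at_imp_continuous_on)
  have fc: "continuous_on {0..} ?f"
    by (intro continuous_intros continuous_on_compose2[OF G]) auto
  have gc: "continuous_on {0..} ?g"
    using p by (intro continuous_intros continuous_on_compose2[OF Hc] continuous_on_powr' v) auto
  have R2: "r\<^sup>2 > R\<^sup>2" if "r > R" for r using that R by (intro power_strict_mono) auto
  have "model_metric \<psi> x (model_grad \<psi> ?\<phi> x) (model_grad \<psi> ?\<phi> x) = ?f (norm x)" for x :: "real ^ 'n"
    using model_metric_grad_comp_inner_self[OF pos H(1)] by (simp add: power2_norm_eq_inner)
  moreover have "\<bar>radial_function v x\<bar> powr (p - 1) * (?\<phi> x)\<^sup>2 = ?g (norm x)" for x :: "real ^ 'n"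
    by (simp add: radial_function_def power2_norm_eq_inner)
  ultimately have "0 \<le> (\<integral>x. ?f (norm x) \<partial>(model_volume \<psi> :: (real ^ 'n) measure))
      - p * (\<integral>x. ?g (norm x) \<partial>(model_volume \<psi> :: (real ^ 'n) measure))"
    using stable H(2) unfolding stable_on_model_def by force
  also have "\<dots> = ?K * ?I ?f - p * (?K * ?I ?g)"
    using zero R2
    by (subst (1 2) integral_model_volume_radial[OF pos psi, where R = R]) (auto intro: fc gc)
  also have "\<dots> = ?K * (?I ?f - p * ?I ?g)" by (simp add: algebra_simps)
  also have "?I ?f - p * ?I ?g = ?I (\<lambda>r. ?f r - p * ?g r)"
  proof -
    have "?I (\<lambda>r. ?f r - p * ?g r) =
        integral {0..R} (\<lambda>r. \<psi> r ^ (CARD('n) - 1) * ?f r - p * (\<psi> r ^ (CARD('n) - 1) * ?g r))"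
      by (simp add: algebra_simps)
    also have "\<dots> = ?I ?f - integral {0..R} (\<lambda>r. p * (\<psi> r ^ (CARD('n) - 1) * ?g r))"
      by (intro Henstock_Kurzweil_Integration.integral_diff integrable_continuous_real continuous_intros
          continuous_on_subset[OF psi(2)] continuous_on_subset[OF fc] continuous_on_subset[OF gc]) auto
    finally show ?thesis by simp
  qed
  finally have "0 \<le> ?K * ?I (\<lambda>r. ?f r - p * ?g r)" .
  moreover have "?K > 0" by simp
  ultimately show ?thesis by (simp only: zero_le_mult_iff not_le[symmetric] simp_thms)
qed

lemma flat_exp_scaled_tendsto:
  assumes "t > 0"
  shows "(\<lambda>k. flat_exp (\<lambda>_. 1) (real (Suc k) * t)) \<longlonglongrightarrow> 1"
proof -
  have "(\<lambda>k. exp (- (inverse (real (Suc k)) * (1 / t)))) \<longlonglongrightarrow> exp (- (0 * (1 / t)))"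
    by (intro tendsto_intros LIMSEQ_inverse_real_of_nat)
  then show ?thesis
    using assms by (simp add: flat_exp_def divide_inverse)
qed

text \<open>
  The function \<open>w\<close> extended by 0 beyond \<open>R\<close> is only Lipschitz continuous. As a function of
  \<open>s = r\<^sup>2\<close> it has the derivative \<open>q(\<surd>s)/2\<close> on \<open>[0,R\<^sup>2]\<close>, where \<open>q(r) = w'(r)/r\<close>. The derivative
  of the approximation is a polynomial close to it times a flat cutoff that tends to 1 below
  \<open>R\<^sup>2\<close>. Then the radial derivatives converge boundedly, and integration from \<open>R\<close> inwards gives
  the convergence of the functions themselves, because both vanish at \<open>R\<close>.
\<close>
lemma exists_radial_test_function_approximation:
  assumes R: "R > 0"
    and w: "\<And>r. r \<in> {0..R} \<Longrightarrow> (w has_real_derivative r * q r) (at r within {0..R})"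
    and q: "continuous_on {0..R} q" and w0: "w R = 0"
  obtains H G :: "nat \<Rightarrow> real \<Rightarrow> real" and M N where
    "\<And>k s. (H k has_real_derivative G k s) (at s)" "\<And>k. continuous_on UNIV (G k)"
    "\<And>k. (\<lambda>x :: real ^ 'n::finite. H k (x \<bullet> x)) \<in> test_functions"
    "\<And>k s. s \<ge> R\<^sup>2 \<Longrightarrow> H k s = 0" "\<And>k s. s \<ge> R\<^sup>2 \<Longrightarrow> G k s = 0"
    "\<And>k r. r \<in> {0..R} \<Longrightarrow> \<bar>2 * r * G k (r\<^sup>2)\<bar> \<le> M" "\<And>k r. r \<in> {0..R} \<Longrightarrow> \<bar>H k (r\<^sup>2)\<bar> \<le> N"
    "\<And>r. r \<in> {0..<R} \<Longrightarrow> (\<lambda>k. 2 * r * G k (r\<^sup>2)) \<longlonglongrightarrow> r * q r"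
    "\<And>r. r \<in> {0..R} \<Longrightarrow> (\<lambda>k. H k (r\<^sup>2)) \<longlonglongrightarrow> w r"
proof -
  define G0 where "G0 = (\<lambda>s. q (sqrt s) / 2)"
  have sqrtR: "sqrt s \<in> {0..R}" if "s \<in> {0..R\<^sup>2}" for s
    using that R real_le_lsqrt by auto
  have G0c: "continuous_on {0..R\<^sup>2} G0"
    unfolding G0_def using sqrtR
    by (intro continuous_intros continuous_on_compose2[OF q]) auto
  have "\<exists>P. real_polynomial_function P \<and> (\<forall>s\<in>{0..R\<^sup>2}. \<bar>G0 s - P s\<bar> < inverse (real (Suc k)))" for k
    by (rule Stone_Weierstrass_real_polynomial_function[OF compact_Icc G0c, of "inverse (real (Suc k))"])
      auto
  then obtain P where P: "\<And>k. real_polynomial_function (P k)"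
    "\<And>k s. s \<in> {0..R\<^sup>2} \<Longrightarrow> \<bar>G0 s - P k s\<bar> < inverse (real (Suc k))"
    by metis
  define G where "G = (\<lambda>k s. P k s * flat_exp (\<lambda>_. 1) (real (Suc k) * (R\<^sup>2 - s)))"
  have "\<exists>H. (\<forall>s. (H has_real_derivative G k s) (at s)) \<and> (\<forall>s\<ge>R\<^sup>2. H s = 0) \<and>
      (\<lambda>x :: real ^ 'n. H (x \<bullet> x)) \<in> test_functions" for k
    unfolding G_def by (rule exists_radial_test_function[OF P(1), of "real (Suc k)"]) auto
  then obtain H where H: "\<And>k s. (H k has_real_derivative G k s) (at s)"
    "\<And>k s. s \<ge> R\<^sup>2 \<Longrightarrow> H k s = 0" "\<And>k. (\<lambda>x :: real ^ 'n. H k (x \<bullet> x)) \<in> test_functions"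
    by metis
  have Gc: "continuous_on UNIV (G k)" for k
    unfolding G_def
    by (intro continuous_on_mult continuous_at_imp_continuous_on ballI
        continuous_real_polymonial_function[OF P(1)] isCont_o2[OF _ isCont_flat_exp]) auto
  have Gz: "G k s = 0" if "s \<ge> R\<^sup>2" for k s
    using that by (simp add: G_def flat_exp_def zero_less_mult_iff)
  obtain B where B: "\<And>s. s \<in> {0..R\<^sup>2} \<Longrightarrow> \<bar>G0 s\<bar> \<le> B"
    using continuous_on_compact_bound[OF compact_Icc G0c] unfolding real_norm_def by metis
  have r2: "r\<^sup>2 \<in> {0..R\<^sup>2}" if "r \<in> {0..R}" for r
    using that by (auto intro: power_mono)
  have GB: "\<bar>G k s\<bar> \<le> B + 1" if "s \<in> {0..R\<^sup>2}" for k s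
  proof -
    have "inverse (real (Suc k)) \<le> 1" by (simp add: inverse_eq_divide)
    then have "\<bar>P k s\<bar> \<le> B + 1" using P(2)[OF that, of k] B[OF that] by linarith
    moreover have "\<bar>flat_exp (\<lambda>_. 1) t\<bar> \<le> 1" for t by (simp add: flat_exp_def)
    ultimately show ?thesis
      unfolding G_def abs_mult using mult_mono[of "\<bar>P k s\<bar>" "B + 1" _ 1] by fastforce
  qed
  define M where "M = 2 * R * (B + 1)"
  have "B + 1 \<ge> 0" using GB[of 0] R by (smt (verit) atLeastAtMost_iff zero_le_power2)
  have GM: "\<bar>2 * r * G k (r\<^sup>2)\<bar> \<le> M" if "r \<in> {0..R}" for k r
    unfolding M_def abs_mult using GB[OF r2[OF that]] that \<open>B + 1 \<ge> 0\<close>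
    by (intro mult_mono) auto
  have Glim: "(\<lambda>k. 2 * r * G k (r\<^sup>2)) \<longlonglongrightarrow> r * q r" if "r \<in> {0..<R}" for r
  proof -
    have r: "r \<in> {0..R}" using that by auto
    have "(\<lambda>k. P k (r\<^sup>2) - G0 (r\<^sup>2)) \<longlonglongrightarrow> 0"
      using P(2)[OF r2[OF r]]
      by (intro Lim_null_comparison[OF _ LIMSEQ_inverse_real_of_nat] always_eventually allI)
         (simp add: abs_minus_commute less_imp_le)
    then have "(\<lambda>k. P k (r\<^sup>2)) \<longlonglongrightarrow> G0 (r\<^sup>2)" by (rule LIM_zero_cancel)
    moreover have "R\<^sup>2 - r\<^sup>2 > 0"
      using that power_strict_mono[of r R 2] by simp
    ultimately have "(\<lambda>k. 2 * r * G k (r\<^sup>2)) \<longlonglongrightarrow> 2 * r * (G0 (r\<^sup>2) * 1)"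
      unfolding G_def by (intro tendsto_intros flat_exp_scaled_tendsto)
    then show ?thesis using that by (simp add: G0_def)
  qed
  have Hint: "((\<lambda>t. 2 * t * G k (t\<^sup>2)) has_integral (- H k (r\<^sup>2))) {r..R}" if "r \<in> {0..R}" for k r
  proof -
    have "((\<lambda>t. 2 * t * G k (t\<^sup>2)) has_integral (H k (R\<^sup>2) - H k (r\<^sup>2))) {r..R}"
    proof (rule fundamental_theorem_of_calculus)
      fix t
      have "((\<lambda>t. H k (t\<^sup>2)) has_real_derivative G k (t\<^sup>2) * (2 * t)) (at t within {r..R})"
        by (rule DERIV_chain2[OF H(1)]) (auto intro!: derivative_eq_intros)
      then show "((\<lambda>t. H k (t\<^sup>2)) has_vector_derivative 2 * t * G k (t\<^sup>2)) (at t within {r..R})"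
        by (simp add: has_real_derivative_iff_has_vector_derivative mult_ac)
    qed (use that in auto)
    then show ?thesis by (simp add: H(2))
  qed
  have wint: "((\<lambda>t. t * q t) has_integral (- w r)) {r..R}" if "r \<in> {0..R}" for r
  proof -
    have "((\<lambda>t. t * q t) has_integral (w R - w r)) {r..R}"
      using that w
      by (intro fundamental_theorem_of_calculus)
         (auto simp: has_real_derivative_iff_has_vector_derivative[symmetric] intro!: DERIV_subset[OF w])
    then show ?thesis by (simp add: w0)
  qed
  have "M \<ge> 0" using R \<open>B + 1 \<ge> 0\<close> by (simp add: M_def)
  have HN: "\<bar>H k (r\<^sup>2)\<bar> \<le> M * R" if "r \<in> {0..R}" for k r
  proof -
    have "norm (- H k (r\<^sup>2)) \<le> M * measure lborel (cbox r R)"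
      using Hint[OF that] GM that \<open>M \<ge> 0\<close>
      by (intro has_integral_bound[where f = "\<lambda>t. 2 * t * G k (t\<^sup>2)"]) auto
    also have "\<dots> \<le> M * R" using that \<open>M \<ge> 0\<close> by (intro mult_left_mono) auto
    finally show ?thesis by simp
  qed
  have Hlim: "(\<lambda>k. H k (r\<^sup>2)) \<longlonglongrightarrow> w r" if "r \<in> {0..R}" for r
  proof -
    (* The value at R is the limit of the cut off derivatives; it does not affect the integral. *)
    let ?g = "\<lambda>t. if t = R then 0 else t * q t"
    have "(\<lambda>k. integral {r..R} (\<lambda>t. 2 * t * G k (t\<^sup>2))) \<longlonglongrightarrow> integral {r..R} ?g"
    proof (rule dominated_convergence)
      show "(\<lambda>t. 2 * t * G k (t\<^sup>2)) integrable_on {r..R}" for k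
        using Hint[OF that] by (auto simp: integrable_on_def)
      show "(\<lambda>_. M) integrable_on {r..R}" by auto
      show "norm (2 * t * G k (t\<^sup>2)) \<le> M" if "t \<in> {r..R}" for k t
        using GM[of t k] that \<open>r \<in> {0..R}\<close> by auto
      show "(\<lambda>k. 2 * t * G k (t\<^sup>2)) \<longlonglongrightarrow> ?g t" if "t \<in> {r..R}" for t
        using Glim[of t] that \<open>r \<in> {0..R}\<close> by (auto simp: Gz)
    qed
    moreover have "integral {r..R} ?g = integral {r..R} (\<lambda>t. t * q t)"
      by (rule integral_spike[of "{R}"]) auto
    ultimately have "(\<lambda>k. - H k (r\<^sup>2)) \<longlonglongrightarrow> - w r"
      using integral_unique[OF Hint[OF that]] integral_unique[OF wint[OF that]] by simp
    from tendsto_minus[OF this] show ?thesis by simp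
  qed
  show ?thesis
    by (rule that[OF H(1) Gc H(3,2) Gz GM HN Glim Hlim])
qed

text \<open>
  Stability is a statement about smooth test functions. By bounded convergence it extends to radial
  functions that vanish on the boundary of a ball and are continued by 0, which are the ones
  needed to compare solutions.
\<close>
lemma stability_inequality_radial:
  assumes pos: "\<And>r. r > 0 \<Longrightarrow> \<psi> r > 0"
    and psi: "\<psi> 0 = 0" "continuous_on {0..} \<psi>" "(\<psi> has_real_derivative 1) (at 0 within {0..})"
    and p: "p > 1" and v: "continuous_on {0..} v"
    and stable: "stable_on_model p \<psi> (radial_function v :: real ^ 'n::finite \<Rightarrow> real)"
    and R: "R > 0"
    and w: "\<And>r. r \<in> {0..R} \<Longrightarrow> (w has_real_derivative r * q r) (at r within {0..R})"
    and q: "continuous_on {0..R} q" and w0: "w R = 0"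
  shows "integral {0..R} (\<lambda>r. \<psi> r ^ (CARD('n) - 1) *
    ((r * q r)\<^sup>2 - p * (\<bar>v r\<bar> powr (p - 1) * (w r)\<^sup>2))) \<ge> 0"
proof -
  obtain H G :: "nat \<Rightarrow> real \<Rightarrow> real" and M N where
    H: "\<And>k s. (H k has_real_derivative G k s) (at s)" "\<And>k. continuous_on UNIV (G k)"
      "\<And>k. (\<lambda>x :: real ^ 'n::finite. H k (x \<bullet> x)) \<in> test_functions"
      "\<And>k s. s \<ge> R\<^sup>2 \<Longrightarrow> H k s = 0" "\<And>k s. s \<ge> R\<^sup>2 \<Longrightarrow> G k s = 0"
    and bound: "\<And>k r. r \<in> {0..R} \<Longrightarrow> \<bar>2 * r * G k (r\<^sup>2)\<bar> \<le> M" "\<And>k r. r \<in> {0..R} \<Longrightarrow> \<bar>H k (r\<^sup>2)\<bar> \<le> N"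
    and lim: "\<And>r. r \<in> {0..<R} \<Longrightarrow> (\<lambda>k. 2 * r * G k (r\<^sup>2)) \<longlonglongrightarrow> r * q r"
      "\<And>r. r \<in> {0..R} \<Longrightarrow> (\<lambda>k. H k (r\<^sup>2)) \<longlonglongrightarrow> w r"
    using exists_radial_test_function_approximation[OF R w q w0, where 'n = 'n] by blast
  let ?a = "\<lambda>r. \<psi> r ^ (CARD('n) - 1)" and ?b = "\<lambda>r. \<bar>v r\<bar> powr (p - 1)"
  let ?F = "\<lambda>k r. ?a r * ((2 * r * G k (r\<^sup>2))\<^sup>2 - p * (?b r * (H k (r\<^sup>2))\<^sup>2))"
  (* The derivatives of the approximations all vanish at R, so there they do not tend to R * q R. *)
  let ?g = "\<lambda>r. if r = R then 0 else r * q r"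
  have ac: "continuous_on {0..R} ?a" and bc: "continuous_on {0..R} ?b"
    using p by (auto intro!: continuous_intros continuous_on_powr' continuous_on_subset[OF v]
        continuous_on_subset[OF psi(2)])
  obtain A where A: "\<And>r. r \<in> {0..R} \<Longrightarrow> \<bar>?a r\<bar> \<le> A"
    using continuous_on_compact_bound[OF compact_Icc ac] unfolding real_norm_def by metis
  obtain B where B: "B \<ge> 0" "\<And>r. r \<in> {0..R} \<Longrightarrow> \<bar>?b r\<bar> \<le> B"
    using continuous_on_compact_bound[OF compact_Icc bc] unfolding real_norm_def by metis
  have Hc: "continuous_on UNIV (H k)" for k
    using H(1) by (meson DERIV_isCont continuous_at_imp_continuous_on)
  have "(\<lambda>k. integral {0..R} (?F k)) \<longlonglongrightarrow>
      integral {0..R} (\<lambda>r. ?a r * ((?g r)\<^sup>2 - p * (?b r * (w r)\<^sup>2)))"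
  proof (rule dominated_convergence)
    show "?F k integrable_on {0..R}" for k
      by (intro integrable_continuous_real continuous_intros ac bc
          continuous_on_compose2[OF Hc] continuous_on_compose2[OF H(2)]) auto
    show "(\<lambda>_. A * (M\<^sup>2 + p * (B * N\<^sup>2))) integrable_on {0..R}" by auto
    show "norm (?F k r) \<le> A * (M\<^sup>2 + p * (B * N\<^sup>2))" if "r \<in> {0..R}" for k r
    proof -
      have "(2 * r * G k (r\<^sup>2))\<^sup>2 \<le> M\<^sup>2" "(H k (r\<^sup>2))\<^sup>2 \<le> N\<^sup>2"
        using bound[OF that, of k] by (simp_all only: abs_le_square_iff[symmetric])
      moreover have "?b r * (H k (r\<^sup>2))\<^sup>2 \<le> B * N\<^sup>2"
        using B(2)[OF that] B(1) calculation(2) by (intro mult_mono) auto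
      then have "p * (?b r * (H k (r\<^sup>2))\<^sup>2) \<le> p * (B * N\<^sup>2)"
        using p by (intro mult_left_mono) auto
      moreover have "0 \<le> p * (?b r * (H k (r\<^sup>2))\<^sup>2)" "0 \<le> (2 * r * G k (r\<^sup>2))\<^sup>2"
        using p by auto
      ultimately have "\<bar>(2 * r * G k (r\<^sup>2))\<^sup>2 - p * (?b r * (H k (r\<^sup>2))\<^sup>2)\<bar> \<le> M\<^sup>2 + p * (B * N\<^sup>2)"
        by linarith
      then show ?thesis
        unfolding real_norm_def abs_mult[of "?a r"] using A[OF that] by (intro mult_mono) auto
    qed
    show "(\<lambda>k. ?F k r) \<longlonglongrightarrow> ?a r * ((?g r)\<^sup>2 - p * (?b r * (w r)\<^sup>2))" if "r \<in> {0..R}" for r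
    proof -
      have "(\<lambda>k. 2 * r * G k (r\<^sup>2)) \<longlonglongrightarrow> ?g r"
        using lim(1)[of r] that by (auto simp: H(5))
      then show ?thesis by (intro tendsto_intros lim(2) that)
    qed
  qed
  moreover have "integral {0..R} (?F k) \<ge> 0" for k
    using R by (intro stability_inequality_comp_inner_self[OF pos psi p v stable H(1,3,2)] H(4,5)) auto
  ultimately have "integral {0..R} (\<lambda>r. ?a r * ((?g r)\<^sup>2 - p * (?b r * (w r)\<^sup>2))) \<ge> 0"
    by (intro LIMSEQ_le_const[of _ _ 0]) auto
  moreover have "integral {0..R} (\<lambda>r. ?a r * ((?g r)\<^sup>2 - p * (?b r * (w r)\<^sup>2))) =
      integral {0..R} (\<lambda>r. ?a r * ((r * q r)\<^sup>2 - p * (?b r * (w r)\<^sup>2)))"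
    by (rule integral_spike[of "{R}"]) auto
  ultimately show ?thesis by simp
qed

section \<open>Comparison of radial profiles\<close>

text \<open>
  What the comparison arguments need to know about a radial solution. The derivative \<open>v'\<close> is an
  argument, and away from the pole \<open>v''\<close> occurs only through the divergence form, so that the predicate
  fits solutions of the initial value problem as well as profiles of solutions on the model.
\<close>
definition radial_profile ::
    "nat \<Rightarrow> real \<Rightarrow> (real \<Rightarrow> real) \<Rightarrow> (real \<Rightarrow> real) \<Rightarrow> (real \<Rightarrow> real) \<Rightarrow> bool" where
  "radial_profile n p \<psi> v v' \<longleftrightarrow>
     (\<forall>r\<ge>0. (v has_real_derivative v' r) (at r within {0..})) \<and>
     v' 0 = 0 \<and> continuous_on {0..} v' \<and> v' differentiable (at 0 within {0..}) \<and>
     (\<forall>r>0. ((\<lambda>s. \<psi> s ^ (n - 1) * v' s) has_real_derivative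
        - (\<psi> r ^ (n - 1) * (\<bar>v r\<bar> powr (p - 1) * v r))) (at r))"

lemma radial_profile_continuous_on:
  "radial_profile n p \<psi> v v' \<Longrightarrow> continuous_on {0..} v"
  by (auto simp: radial_profile_def intro!: DERIV_continuous_on)

lemma at_within_atLeast_0: "r > 0 \<Longrightarrow> at (r::real) within {0..} = at r"
  by (rule at_within_interior) simp

lemma C2_half_line_has_real_derivative:
  assumes "C2_half_line f" "r \<ge> 0"
  shows "(f has_real_derivative hderiv f r) (at r within {0..})"
    and "(hderiv f has_real_derivative hderiv (hderiv f) r) (at r within {0..})"
  using assms
  by (auto simp: C2_half_line_def differentiable_on_def hderiv_def[of f] hderiv_def[of "hderiv f"]
      has_real_derivative_iff_has_vector_derivative vector_derivative_works[symmetric])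

lemma radial_IVP_solution_imp_radial_profile:
  assumes "radial_IVP_solution n p \<psi> \<alpha> u" and psi: "C2_half_line \<psi>" "\<And>r. r > 0 \<Longrightarrow> \<psi> r > 0"
  shows "radial_profile n p \<psi> u (hderiv u)"
proof -
  have u: "C2_half_line u" "hderiv u 0 = 0"
    and ode: "\<And>r. r > 0 \<Longrightarrow> - (1 / \<psi> r ^ (n - 1)) * hderiv (\<lambda>s. \<psi> s ^ (n - 1) * hderiv u s) r
      = \<bar>u r\<bar> powr (p - 1) * u r"
    using assms(1) by (auto simp: radial_IVP_solution_def)
  have "((\<lambda>s. \<psi> s ^ (n - 1) * hderiv u s) has_real_derivative
      - (\<psi> r ^ (n - 1) * (\<bar>u r\<bar> powr (p - 1) * u r))) (at r)" if r: "r > 0" for r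
  proof -
    note d = DERIV_mult[OF DERIV_power[OF C2_half_line_has_real_derivative(1)[OF psi(1)]]
        C2_half_line_has_real_derivative(2)[OF u(1)], of r "n - 1"]
    obtain D where D: "((\<lambda>s. \<psi> s ^ (n - 1) * hderiv u s) has_real_derivative D) (at r)"
      using d r by (auto simp: at_within_atLeast_0)
    then have "hderiv (\<lambda>s. \<psi> s ^ (n - 1) * hderiv u s) r = D"
      using r
      by (auto simp: hderiv_def at_within_atLeast_0 has_real_derivative_iff_has_vector_derivative
          intro: vector_derivative_at)
    then have "D = - (\<psi> r ^ (n - 1) * (\<bar>u r\<bar> powr (p - 1) * u r))"
      using ode[OF r] psi(2)[OF r] by (simp add: field_simps)
    then show ?thesis using D by simp
  qed
  moreover have "continuous_on {0..} (hderiv u)"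
    using C2_half_line_has_real_derivative(2)[OF u(1)] by (auto intro!: DERIV_continuous_on)
  ultimately show ?thesis
    using u C2_half_line_has_real_derivative(1)[OF u(1)]
    by (auto simp: radial_profile_def C2_half_line_def differentiable_on_def)
qed

text \<open>
  The reason is a decreasing energy. Let \<open>F' = f\<close> with
  \<open>f(t) = \<bar>t\<bar>\<^bsup>p-1\<^esup> t\<close>. The energy \<open>v'\<^sup>2/2 + F(v)\<close> has the derivative \<open>-(n-1) (\<psi>'/\<psi>) v'\<^sup>2 \<le> 0\<close>,
  because \<open>\<psi>' \<ge> 0\<close>, and it starts at \<open>F 0\<close>, the minimum of \<open>F\<close>. Hence \<open>v' = 0\<close>.
\<close>
lemma radial_profile_zero_unique:
  assumes v: "radial_profile n p \<psi> v v'" and "v 0 = 0" and p: "p > 1"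
    and pos: "\<And>r. r > 0 \<Longrightarrow> \<psi> r > 0"
    and psi: "\<And>r. r > 0 \<Longrightarrow> (\<psi> has_real_derivative \<psi>' r) (at r)" "\<And>r. r > 0 \<Longrightarrow> \<psi>' r \<ge> 0"
    and "r \<ge> 0"
  shows "v r = 0"
proof -
  have v_der: "\<And>r. r \<ge> 0 \<Longrightarrow> (v has_real_derivative v' r) (at r within {0..})"
    and v'0: "v' 0 = 0" and v'c: "continuous_on {0..} v'"
    and ode: "\<And>r. r > 0 \<Longrightarrow> ((\<lambda>s. \<psi> s ^ (n - 1) * v' s) has_real_derivative
        - (\<psi> r ^ (n - 1) * (\<bar>v r\<bar> powr (p - 1) * v r))) (at r)"
    using v by (auto simp: radial_profile_def)
  let ?f = "\<lambda>t::real. \<bar>t\<bar> powr (p - 1) * t"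
  have "continuous_on UNIV ?f"
    using p by (intro continuous_intros continuous_on_powr') auto
  then have "isCont ?f t" for t by (simp add: continuous_on_eq_continuous_at)
  then obtain F where F: "\<And>t. (F has_real_derivative ?f t) (at t)"
    using einterval_antiderivative[of "-\<infinity>" "\<infinity>" ?f]
    by (auto simp: has_real_derivative_iff_has_vector_derivative)
  have Fc: "continuous_on UNIV F"
    using F by (meson DERIV_isCont continuous_at_imp_continuous_on)
  have F_ge: "F 0 \<le> F t" for t
  proof (cases "t \<ge> 0")
    case True
    then show ?thesis
    proof (rule DERIV_nonneg_imp_nondecreasing)
      fix x :: real assume "0 \<le> x"
      then show "\<exists>y. (F has_real_derivative y) (at x) \<and> 0 \<le> y"
        using F[of x] by (intro exI[of _ "?f x"]) simp
    qed
  next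
    case False
    then have "t \<le> 0" by simp
    then show ?thesis
    proof (rule DERIV_nonpos_imp_nonincreasing)
      fix x :: real assume "x \<le> 0"
      then show "\<exists>y. (F has_real_derivative y) (at x) \<and> y \<le> 0"
        using F[of x] by (intro exI[of _ "?f x"]) (simp add: mult_nonneg_nonpos)
    qed
  qed
  let ?E = "\<lambda>s. (v' s)\<^sup>2 / 2 + F (v s)"
  have v'_0: "v' s = 0" if "s \<ge> 0" for s
  proof -
    have "?E s \<le> ?E 0"
    proof (rule DERIV_nonpos_imp_decreasing_open[where f = ?E])
      show "0 \<le> s" by fact
      have "continuous_on {0..s} v" "continuous_on {0..s} v'"
        using radial_profile_continuous_on[OF v] v'c by (auto intro: continuous_on_subset)
      moreover from this have "continuous_on {0..s} (\<lambda>s. F (v s))"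
        by (intro continuous_on_compose2[OF Fc]) auto
      ultimately show "continuous_on {0..s} ?E"
        by (intro continuous_on_add continuous_on_divide continuous_on_power continuous_on_const) auto
      fix t assume t: "0 < t" "t < s"
      let ?a = "\<lambda>s. \<psi> s ^ (n - 1)" and ?a' = "real (n - 1) * \<psi> t ^ (n - 1 - 1) * \<psi>' t"
      have a: "?a t > 0" "?a' \<ge> 0"
        using pos[OF t(1)] psi(2)[OF t(1)] by auto
      have da: "(?a has_real_derivative ?a') (at t)"
        using DERIV_power[OF psi(1)[OF t(1)], of "n - 1"] by (simp add: mult_ac)
      (* The divergence form is solved for v'' by dividing by the weight. *)
      have quot: "(- (A * y) * A - A * z * A') / (A * A) = - y - A' / A * z" if "A > 0" for A A' y z :: real
        using that by (simp add: field_simps)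
      have "((\<lambda>s. ?a s * v' s / ?a s) has_real_derivative - ?f (v t) - ?a' / ?a t * v' t) (at t)"
        using a(1) pos[OF t(1)] by (intro DERIV_cong[OF DERIV_divide[OF ode[OF t(1)] da] quot]) auto
      then have dv': "(v' has_real_derivative - ?f (v t) - ?a' / ?a t * v' t) (at t)"
      proof (rule has_field_derivative_transform_within_open)
        show "open {0::real<..}" "t \<in> {0<..}" using t by auto
        show "?a s * v' s / ?a s = v' s" if "s \<in> {0<..}" for s
          using pos[of s] that by simp
      qed
      have dv: "(v has_real_derivative v' t) (at t)"
        using v_der[of t] t by (simp add: at_within_atLeast_0)
      have energy: "real 2 * ((- y - c * z) * z ^ (2 - Suc 0)) / 2 + y * z = - (c * z\<^sup>2)" for c y z :: real
        by (simp add: field_simps power2_eq_square)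
      have "(?E has_real_derivative - (?a' / ?a t * (v' t)\<^sup>2)) (at t)"
        by (rule DERIV_cong[OF DERIV_add[OF DERIV_cdivide[OF DERIV_power[OF dv', of 2], of 2]
              DERIV_chain2[OF F dv]] energy])
      moreover have "- (?a' / ?a t * (v' t)\<^sup>2) \<le> 0"
        using a by simp
      ultimately show "\<exists>y. (?E has_real_derivative y) (at t) \<and> y \<le> 0" by blast
    qed
    then have "(v' s)\<^sup>2 / 2 + F (v s) \<le> F 0" using \<open>v 0 = 0\<close> v'0 by simp
    then have "(v' s)\<^sup>2 \<le> 0" using F_ge[of "v s"] by linarith
    then show ?thesis by simp
  qed
  then obtain c where "\<forall>r\<in>{0..}. v r = c"
    using has_field_derivative_zero_constant[of "{0..}" v] v_der by fastforce
  then show ?thesis using \<open>v 0 = 0\<close> \<open>r \<ge> 0\<close> by auto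
qed

text \<open>
  The engine of all comparison results. If \<open>-\<Delta>w = h\<close> and \<open>w\<close> vanishes on the sphere of radius
  \<open>R\<close>, then integration by parts over the ball gives \<open>\<integral>\<bar>\<nabla>w\<bar>\<^sup>2 = \<integral>h w\<close>, while stability of \<open>v\<close>
  gives \<open>\<integral>\<bar>\<nabla>w\<bar>\<^sup>2 \<ge> p \<integral>\<bar>v\<bar>\<^bsup>p-1\<^esup> w\<^sup>2\<close>. So a pointwise inequality in the opposite direction
  must be an equality.
\<close>
lemma stability_comparison:
  assumes pos: "\<And>r. r > 0 \<Longrightarrow> \<psi> r > 0"
    and psi: "\<psi> 0 = 0" "continuous_on {0..} \<psi>" "(\<psi> has_real_derivative 1) (at 0 within {0..})"
    and p: "p > 1" and v: "continuous_on {0..} v"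
    and stable: "stable_on_model p \<psi> (radial_function v :: real ^ 'n::finite \<Rightarrow> real)"
    and R: "R > 0"
    and w: "\<And>r. r \<ge> 0 \<Longrightarrow> (w has_real_derivative w' r) (at r within {0..})"
    and w': "w' 0 = 0" "continuous_on {0..} w'" "w' differentiable (at 0 within {0..})"
    and ode: "\<And>r. r > 0 \<Longrightarrow> ((\<lambda>s. \<psi> s ^ (CARD('n) - 1) * w' s) has_real_derivative
        - (\<psi> r ^ (CARD('n) - 1) * h r)) (at r)"
    and h: "continuous_on {0..} h" and w0: "w R = 0"
    and le: "\<And>r. r \<in> {0..R} \<Longrightarrow> h r * w r \<le> p * (\<bar>v r\<bar> powr (p - 1) * (w r)\<^sup>2)"
    and r: "r \<in> {0<..R}"
  shows "h r * w r = p * (\<bar>v r\<bar> powr (p - 1) * (w r)\<^sup>2)"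
proof -
  let ?a = "\<lambda>r. \<psi> r ^ (CARD('n) - 1)" and ?b = "\<lambda>r. p * (\<bar>v r\<bar> powr (p - 1) * (w r)\<^sup>2)"
  have sub: "{0..R} \<subseteq> {0..}" by auto
  have wc: "continuous_on {0..} w" using w by (auto intro!: DERIV_continuous_on)
  have vc': "continuous_on {0..R} v" and wc': "continuous_on {0..R} w"
    and hc: "continuous_on {0..R} h" and w'c: "continuous_on {0..R} w'"
    and psic: "continuous_on {0..R} \<psi>"
    using v wc h w'(2) psi(2) by (auto intro: continuous_on_subset)
  have ac: "continuous_on {0..R} ?a"
    by (intro continuous_on_power psic)
  have bc: "continuous_on {0..R} ?b"
    using p by (intro continuous_on_mult continuous_on_power continuous_on_powr' continuous_on_const
        continuous_on_rabs vc' wc') auto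
  obtain d where d: "(w' has_real_derivative d) (at 0 within {0..})"
    using w'(3) by (auto simp: real_differentiable_def)
  define q where "q = (\<lambda>r. if r = 0 then d else w' r / r)"
  have rq: "r * q r = w' r" for r by (simp add: q_def w'(1))
  have "continuous_on {0..} q"
    unfolding q_def by (rule continuous_on_difference_quotient_at_0[OF w'(1,2) d])
  then have qc: "continuous_on {0..R} q" by (rule continuous_on_subset[OF _ sub])
  have stab: "integral {0..R} (\<lambda>r. ?a r * ((r * q r)\<^sup>2 - ?b r)) \<ge> 0"
  proof (rule stability_inequality_radial[where w = w])
    show "(w has_real_derivative r * q r) (at r within {0..R})" if "r \<in> {0..R}" for r
      unfolding rq using w[of r] that sub by (auto intro: DERIV_subset)
  qed (fact pos psi p v stable R qc w0)+
  have "((\<lambda>r. ?a r * ((w' r)\<^sup>2 - h r * w r)) has_integral (?a R * w' R * w R - ?a 0 * w' 0 * w 0)) {0..R}"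
  proof (rule fundamental_theorem_of_calculus_interior)
    show "continuous_on {0..R} (\<lambda>r. ?a r * w' r * w r)"
      by (intro continuous_intros ac w'c wc')
    fix r assume r: "r \<in> {0<..<R}"
    have "(w has_real_derivative w' r) (at r)"
      using w[of r] r by (simp add: at_within_atLeast_0)
    from DERIV_mult[OF ode this] r
    have "((\<lambda>r. ?a r * w' r * w r) has_real_derivative ?a r * ((w' r)\<^sup>2 - h r * w r)) (at r)"
      by (simp add: algebra_simps power2_eq_square)
    then show "((\<lambda>r. ?a r * w' r * w r) has_vector_derivative ?a r * ((w' r)\<^sup>2 - h r * w r)) (at r)"
      by (simp add: has_real_derivative_iff_has_vector_derivative)
  qed (use R in auto)
  then have ident: "integral {0..R} (\<lambda>r. ?a r * ((w' r)\<^sup>2 - h r * w r)) = 0"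
    by (simp add: w0 w'(1) integral_unique)
  have "integral {0..R} (\<lambda>r. ?a r * ((w' r)\<^sup>2 - h r * w r) - ?a r * ((w' r)\<^sup>2 - ?b r)) =
      integral {0..R} (\<lambda>r. ?a r * ((w' r)\<^sup>2 - h r * w r)) - integral {0..R} (\<lambda>r. ?a r * ((w' r)\<^sup>2 - ?b r))"
    by (intro Henstock_Kurzweil_Integration.integral_diff integrable_continuous_real
        continuous_on_mult continuous_on_diff continuous_on_power ac bc hc w'c wc')
  then have "integral {0..R} (\<lambda>r. ?a r * (?b r - h r * w r)) \<le> 0"
    using stab ident by (simp add: rq algebra_simps)
  moreover have cont: "continuous_on {0..R} (\<lambda>r. ?a r * (?b r - h r * w r))"
    by (intro continuous_on_mult continuous_on_diff ac bc hc wc')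
  moreover have nonneg: "?a r * (?b r - h r * w r) \<ge> 0" if "r \<in> {0..R}" for r
    using le[OF that] pos[of r] psi(1) that by (cases "r = 0") auto
  ultimately have "integral {0..R} (\<lambda>r. ?a r * (?b r - h r * w r)) = 0"
    by (intro antisym Henstock_Kurzweil_Integration.integral_nonneg integrable_continuous_real) auto
  then have "?a r * (?b r - h r * w r) = 0"
    using integral_eq_0_iff[OF cont R nonneg] r by auto
  then show ?thesis using pos[of r] r by auto
qed

text \<open>
  Take \<open>w = v\<close> in the comparison: at a zero \<open>R > 0\<close> of \<open>v\<close> it forces
  \<open>\<bar>v\<bar>\<^bsup>p+1\<^esup> = p \<bar>v\<bar>\<^bsup>p+1\<^esup>\<close> on the ball of radius \<open>R\<close>, hence \<open>v = 0\<close> there since \<open>p > 1\<close>, and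
  uniqueness from the pole propagates this to the whole half-line.
\<close>
lemma stable_radial_profile_no_zero:
  assumes v: "radial_profile CARD('n) p \<psi> v v'" and p: "p > 1"
    and pos: "\<And>r. r > 0 \<Longrightarrow> \<psi> r > 0"
    and psi: "\<psi> 0 = 0" "\<psi>' 0 = 1" "\<And>r. r \<ge> 0 \<Longrightarrow> (\<psi> has_real_derivative \<psi>' r) (at r within {0..})"
      "\<And>r. r > 0 \<Longrightarrow> \<psi>' r \<ge> 0"
    and stable: "stable_on_model p \<psi> (radial_function v :: real ^ 'n::finite \<Rightarrow> real)"
    and R: "R \<ge> 0" "v R = 0" and r: "r \<ge> 0"
  shows "v r = 0"
proof -
  have vc: "continuous_on {0..} v" by (rule radial_profile_continuous_on[OF v])
  have v0: "v 0 = 0"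
  proof (cases "R = 0")
    case False
    then have "R > 0" using R by simp
    let ?h = "\<lambda>r. \<bar>v r\<bar> powr (p - 1) * v r"
    have hv: "?h r * v r = \<bar>v r\<bar> powr (p - 1) * (v r)\<^sup>2" for r by (simp add: power2_eq_square)
    have zero: "v r = 0" if r: "r \<in> {0<..<R}" for r
    proof -
      have "?h r * v r = p * (\<bar>v r\<bar> powr (p - 1) * (v r)\<^sup>2)"
      proof (rule stability_comparison[OF pos psi(1) _ _ p vc stable \<open>R > 0\<close>, where w' = v'])
        show "continuous_on {0..} \<psi>" using psi(3) by (auto intro!: DERIV_continuous_on)
        show "(\<psi> has_real_derivative 1) (at 0 within {0..})" using psi(3)[of 0] psi(2) by simp
        show "continuous_on {0..} ?h"
          using p by (intro continuous_intros continuous_on_powr' vc) auto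
        show "?h r * v r \<le> p * (\<bar>v r\<bar> powr (p - 1) * (v r)\<^sup>2)" for r
          unfolding hv using p mult_right_mono[of 1 p "\<bar>v r\<bar> powr (p - 1) * (v r)\<^sup>2"] by simp
      qed (use v r R in \<open>auto simp: radial_profile_def\<close>)
      then have "(p - 1) * (\<bar>v r\<bar> powr (p - 1) * (v r)\<^sup>2) = 0"
        unfolding hv left_diff_distrib by linarith
      then show ?thesis using p by auto
    qed
    have "continuous_on (closure {0<..<R}) v"
      using \<open>R > 0\<close> continuous_on_subset[OF vc, of "{0..R}"] by simp
    then show ?thesis
      by (rule continuous_constant_on_closure[OF _ zero]) (use \<open>R > 0\<close> in auto)
  qed (use R in simp)
  have psi_at: "(\<psi> has_real_derivative \<psi>' r) (at r)" if "r > 0" for r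
    using psi(3)[of r] that by (simp add: at_within_atLeast_0)
  show ?thesis
    by (rule radial_profile_zero_unique[OF v v0 p pos psi_at psi(4) r])
qed

text \<open>
  Strict convexity of \<open>t\<^sup>p\<close>: a chord is less steep than the tangent at its right end point.
\<close>
lemma abs_powr_mult_less_tangent:
  fixes a b p :: real
  assumes "p > 1" "0 < b" "b < a"
  shows "\<bar>a\<bar> powr (p - 1) * a - \<bar>b\<bar> powr (p - 1) * b < p * (\<bar>a\<bar> powr (p - 1) * (a - b))"
proof -
  have eq: "\<bar>x\<bar> powr (p - 1) * x = x powr p" if "x > 0" for x
    using that powr_mult_base[of x "p - 1"] by (simp add: mult.commute)
  have "\<exists>z. b < z \<and> z < a \<and> a powr p - b powr p = (a - b) * (p * z powr (p - 1))"
    using assms by (intro MVT2) (auto intro!: has_real_derivative_powr)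
  then obtain z where z: "b < z" "z < a" "a powr p - b powr p = (a - b) * (p * z powr (p - 1))" by blast
  have "z powr (p - 1) < a powr (p - 1)" using z assms by (intro powr_less_mono2) auto
  then have "(a - b) * (p * z powr (p - 1)) < (a - b) * (p * a powr (p - 1))"
    using assms by (intro mult_strict_left_mono) auto
  moreover have "\<bar>a\<bar> powr (p - 1) * a = a powr p" "\<bar>b\<bar> powr (p - 1) * b = b powr p"
    by (rule eq, use assms in simp)+
  moreover have "(a - b) * (p * a powr (p - 1)) = p * (\<bar>a\<bar> powr (p - 1) * (a - b))"
    using assms by simp
  ultimately show ?thesis using z(3) by linarith
qed

text \<open>
  Take \<open>w = u - v\<close> in the comparison, up to the first zero \<open>R\<close> of \<open>w\<close>. Since \<open>w > 0\<close> before \<open>R\<close>,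
  convexity gives \<open>(f(u) - f(v)) w < p u\<^bsup>p-1\<^esup> w\<^sup>2\<close> there, in contradiction to the equality that
  stability of the larger solution \<open>u\<close> would imply.
\<close>
lemma stable_radial_profiles_ordered:
  assumes u: "radial_profile CARD('n) p \<psi> u u'" "\<And>r. r \<ge> 0 \<Longrightarrow> u r > 0"
    and v: "radial_profile CARD('n) p \<psi> v v'" "\<And>r. r \<ge> 0 \<Longrightarrow> v r > 0"
    and p: "p > 1"
    and pos: "\<And>r. r > 0 \<Longrightarrow> \<psi> r > 0"
    and psi: "\<psi> 0 = 0" "continuous_on {0..} \<psi>" "(\<psi> has_real_derivative 1) (at 0 within {0..})"
    and stable: "stable_on_model p \<psi> (radial_function u :: real ^ 'n::finite \<Rightarrow> real)"
    and less: "v 0 < u 0" and r: "r \<ge> 0"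
  shows "v r < u r"
proof (rule ccontr)
  assume "\<not> v r < u r"
  define w where "w = (\<lambda>r. u r - v r)"
  note uc = radial_profile_continuous_on[OF u(1)] and vc = radial_profile_continuous_on[OF v(1)]
  have wc: "continuous_on {0..} w" unfolding w_def by (intro continuous_intros uc vc)
  have "\<exists>x\<ge>0. x \<le> r \<and> w x = 0"
    using \<open>\<not> v r < u r\<close> less r
    by (intro IVT2' continuous_on_subset[OF wc]) (auto simp: w_def)
  then obtain x where x: "x \<ge> 0" "w x = 0" by blast
  define Z where "Z = {0..x} \<inter> w -` {0}"
  have "compact Z"
    unfolding compact_eq_bounded_closed Z_def
    by (auto intro!: continuous_closed_preimage continuous_on_subset[OF wc] bounded_Int)
  moreover have "Z \<noteq> {}" using x by (auto simp: Z_def)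
  ultimately obtain R where R: "R \<in> Z" "\<And>y. y \<in> Z \<Longrightarrow> R \<le> y"
    using compact_attains_inf[of Z] by blast
  have wR: "w R = 0" and R0: "R > 0"
    using R(1) less by (auto simp: Z_def w_def intro: order.not_eq_order_implies_strict)
  have wpos: "w y > 0" if y: "y \<in> {0..<R}" for y
  proof (rule ccontr)
    assume "\<not> w y > 0"
    then have "\<exists>z\<ge>0. z \<le> y \<and> w z = 0"
      using less y by (intro IVT2' continuous_on_subset[OF wc]) (auto simp: w_def)
    then obtain z where "z \<ge> 0" "z \<le> y" "w z = 0" by blast
    then show False using R(1) R(2)[of z] y by (auto simp: Z_def)
  qed
  let ?f = "\<lambda>t. \<bar>t\<bar> powr (p - 1) * t"
  let ?h = "\<lambda>r. ?f (u r) - ?f (v r)"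
  have strict: "?h y * w y < p * (\<bar>u y\<bar> powr (p - 1) * (w y)\<^sup>2)" if "y \<in> {0..<R}" for y
  proof -
    have "?h y < p * (\<bar>u y\<bar> powr (p - 1) * w y)"
      unfolding w_def using v(2)[of y] wpos[OF that] that p
      by (intro abs_powr_mult_less_tangent) (auto simp: w_def)
    from mult_strict_right_mono[OF this wpos[OF that]]
    show ?thesis by (simp add: power2_eq_square mult_ac)
  qed
  have "?h (R / 2) * w (R / 2) = p * (\<bar>u (R / 2)\<bar> powr (p - 1) * (w (R / 2))\<^sup>2)"
  proof (rule stability_comparison[OF pos psi p uc stable R0, where w' = "\<lambda>r. u' r - v' r"])
    show "(w has_real_derivative u' r - v' r) (at r within {0..})" if "r \<ge> 0" for r
      unfolding w_def using u(1) v(1) that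
      by (intro DERIV_diff) (auto simp: radial_profile_def)
    show "u' 0 - v' 0 = 0" "continuous_on {0..} (\<lambda>r. u' r - v' r)"
      "(\<lambda>r. u' r - v' r) differentiable (at 0 within {0..})"
      using u(1) v(1) by (auto simp: radial_profile_def intro!: continuous_intros)
    show "((\<lambda>s. \<psi> s ^ (CARD('n) - 1) * (u' s - v' s)) has_real_derivative
        - (\<psi> r ^ (CARD('n) - 1) * ?h r)) (at r)" if "r > 0" for r
      unfolding right_diff_distrib
      by (rule DERIV_cong[OF DERIV_diff[of _ "- (\<psi> r ^ (CARD('n) - 1) * ?f (u r))" _ _ _
          "- (\<psi> r ^ (CARD('n) - 1) * ?f (v r))"]])
         (use u(1) v(1) that in \<open>auto simp: radial_profile_def\<close>)
    show "continuous_on {0..} ?h"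
      using p by (intro continuous_intros continuous_on_powr' uc vc) auto
    show "?h y * w y \<le> p * (\<bar>u y\<bar> powr (p - 1) * (w y)\<^sup>2)" if "y \<in> {0..R}" for y
      using strict[of y] that wR by (cases "y = R") auto
  qed (use R0 wR in auto)
  then show False using strict[of "R / 2"] R0 by simp
qed

section \<open>Radial solutions on the model\<close>

lemma pderiv_at_along_axis:
  fixes f :: "real ^ 'n::finite \<Rightarrow> real"
  assumes "f differentiable at (t *\<^sub>R axis k 1)"
  shows "((\<lambda>t. f (t *\<^sub>R axis k 1)) has_real_derivative pderiv_at k f (t *\<^sub>R axis k 1)) (at t)"
proof -
  let ?e = "axis k 1 :: real ^ 'n"
  have f: "(f has_derivative frechet_derivative f (at (t *\<^sub>R ?e))) (at (t *\<^sub>R ?e))"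
    using assms by (simp add: frechet_derivative_works)
  have "((\<lambda>t. t *\<^sub>R ?e) has_derivative (\<lambda>h. h *\<^sub>R ?e)) (at t)"
    by (intro derivative_eq_intros) auto
  from has_derivative_compose[OF this f]
  show ?thesis
    using linear_cmul[OF has_derivative_linear[OF f]]
    by (simp add: has_field_derivative_def pderiv_at_def mult.commute[of _ "frechet_derivative _ _ _"])
qed

text \<open>
  Away from the pole the field whose Euclidean divergence is taken is \<open>k(r) x\<close> with
  \<open>k(r) = \<psi>(r)\<^bsup>n-1\<^esup> v'(r) / r\<^sup>n\<close>, and the divergence of \<open>k(r) x\<close> is \<open>n k(r) + r k'(r)\<close>.
\<close>
lemma model_laplacian_radial:
  fixes x :: "real ^ 'n::finite"
  assumes pos: "\<And>r. r > 0 \<Longrightarrow> \<psi> r > 0"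
    and v: "\<And>r. r > 0 \<Longrightarrow> (v has_real_derivative v' r) (at r)"
    and x: "x \<noteq> 0"
    and m: "((\<lambda>s. \<psi> s ^ (CARD('n) - 1) * v' s) has_real_derivative d) (at (norm x))"
  shows "model_laplacian \<psi> (radial_function v) x = d / \<psi> (norm x) ^ (CARD('n) - 1)"
proof -
  let ?n = "CARD('n)"
  define r where "r = norm x"
  have r: "r > 0" using x by (simp add: r_def)
  have n: "t ^ ?n = t * t ^ (?n - 1)" for t :: real
    using power_minus_mult[of ?n t] by (simp add: mult.commute)
  define m where "m = \<psi> r ^ (?n - 1) * v' r"
  define A where "A = r ^ (?n - 1)"
  have A: "A > 0" using r by (simp add: A_def)
  let ?k = "\<lambda>t. \<psi> t ^ (?n - 1) * v' t / t ^ ?n"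
  (* The derivative of the quotient m(t) / t^n at r, with r^n written as r * A. *)
  define k' where "k' = (d * (r * A) - m * (?n * A)) / (r * A * (r * A))"
  have "((\<lambda>t. t ^ ?n) has_real_derivative ?n * A) (at r)"
    unfolding A_def by (rule DERIV_cong[OF DERIV_pow]) simp
  from DERIV_divide[OF assms(4)[folded r_def] this]
  have k: "(?k has_real_derivative k') (at r)"
    using r by (simp only: k'_def n[of r] A_def[symmetric] m_def[symmetric]) (simp add: A less_imp_neq[OF A, symmetric])
  have field: "volume_density \<psi> y * model_grad \<psi> (radial_function v) y $ i = ?k (norm y) * y $ i"
    if "y \<in> - {0}" for y :: "real ^ 'n" and i
  proof -
    have y: "y \<noteq> 0" "norm y > 0" using that by auto
    have "model_grad \<psi> (radial_function v) y = (v' (norm y) / norm y) *\<^sub>R y"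
      by (rule model_grad_radial[OF pos y(1) v[OF y(2)]])
    moreover have "volume_density \<psi> y = radial_density ?n \<psi> (norm y)"
      by (rule volume_density_eq[OF pos])
    ultimately show ?thesis
      using y by (simp add: radial_density_def n power_divide mult_ac)
  qed
  have "pderiv_at i (\<lambda>y. volume_density \<psi> y * model_grad \<psi> (radial_function v) y $ i) x =
      ?k r + k' / r * (x $ i * x $ i)" for i
  proof -
    have "((\<lambda>y. ?k (norm y)) has_derivative (\<lambda>h. k' * (x \<bullet> h / norm x))) (at x)"
      using has_derivative_compose[OF has_derivative_norm_at[OF x]
          k[unfolded r_def has_field_derivative_def]] by simp
    from has_derivative_mult[OF this bounded_linear_imp_has_derivative[OF bounded_linear_vec_nth]]
    have "((\<lambda>y. ?k (norm y) * y $ i) has_derivative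
        (\<lambda>h. ?k (norm x) * h $ i + k' * (x \<bullet> h / norm x) * x $ i)) (at x)" .
    then have "((\<lambda>y. volume_density \<psi> y * model_grad \<psi> (radial_function v) y $ i) has_derivative
        (\<lambda>h. ?k (norm x) * h $ i + k' * (x \<bullet> h / norm x) * x $ i)) (at x)"
      by (rule has_derivative_transform_within_open[of _ _ _ _ "- {0}"]) (use x field in auto)
    from pderiv_at_eq[OF this] show ?thesis
      by (simp add: inner_axis r_def)
  qed
  then have "(\<Sum>i\<in>UNIV. pderiv_at i (\<lambda>y. volume_density \<psi> y * model_grad \<psi> (radial_function v) y $ i) x)
      = ?n * ?k r + k' / r * (x \<bullet> x)"
    by (simp add: sum.distrib sum_distrib_left sum_divide_distrib inner_vec_def)
  also have "x \<bullet> x = r * r" by (simp add: r_def power2_norm_eq_inner[symmetric] power2_eq_square)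
  also have "?n * ?k r + k' / r * (r * r) = d / A"
    unfolding n[of r] A_def[symmetric] m_def[symmetric] k'_def
    using r A by (simp add: field_simps)
  finally have sum: "(\<Sum>i\<in>UNIV. pderiv_at i (\<lambda>y. volume_density \<psi> y * model_grad \<psi> (radial_function v) y $ i) x)
      = d / A" .
  have vd: "volume_density \<psi> x = radial_density ?n \<psi> (norm x)"
    by (rule volume_density_eq[OF pos])
  show ?thesis
    unfolding model_laplacian_def model_div_def sum
    using r A vd by (simp add: radial_density_def r_def[symmetric] power_divide A_def)
qed

text \<open>
  The profile of a radial solution is read off along a coordinate axis, where it is defined for
  negative arguments as well; being even, it has derivative 0 at the pole.
\<close>
lemma radial_solution_on_model_profile:
  assumes pos: "\<And>r. r > 0 \<Longrightarrow> \<psi> r > 0"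
    and psi: "\<And>r. r > 0 \<Longrightarrow> (\<psi> has_real_derivative \<psi>' r) (at r)"
    and sol: "solution_on_model p \<psi> (radial_function w :: real ^ 'n::finite \<Rightarrow> real)"
  obtains v v' where "radial_profile CARD('n) p \<psi> v v'"
    "(radial_function w :: real ^ 'n \<Rightarrow> real) = radial_function v"
proof -
  let ?W = "radial_function w :: real ^ 'n \<Rightarrow> real"
  fix k :: 'n
  let ?e = "axis k 1 :: real ^ 'n"
  define v where "v = (\<lambda>t. ?W (t *\<^sub>R ?e))"
  define v' where "v' = (\<lambda>t. pderiv_at k ?W (t *\<^sub>R ?e))"
  define v'' where "v'' = (\<lambda>t. pderiv_at k (pderiv_at k ?W) (t *\<^sub>R ?e))"
  have "C_k (Suc (Suc 0)) ?W" using sol by (simp add: solution_on_model_def numeral_2_eq_2)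
  then have "?W differentiable at x" "pderiv_at k ?W differentiable at x" for x
    by auto
  then have dv: "(v has_real_derivative v' t) (at t)" and dv': "(v' has_real_derivative v'' t) (at t)" for t
    unfolding v_def v'_def v''_def by (intro pderiv_at_along_axis; blast)+
  have Wv: "?W = radial_function v"
    by (rule ext) (simp add: radial_function_def v_def)
  have "v' 0 = 0"
  proof -
    have "(\<lambda>t. v (- t)) = v" by (simp add: v_def radial_function_def)
    moreover have "((\<lambda>t. v (- t)) has_real_derivative v' 0 * (- 1)) (at 0)"
      by (rule DERIV_chain2[of v]) (use dv[of 0] in \<open>auto intro!: derivative_eq_intros\<close>)
    ultimately have "(v has_real_derivative - v' 0) (at 0)" by simp
    from DERIV_unique[OF dv this] show ?thesis by simp
  qed
  moreover have "((\<lambda>s. \<psi> s ^ (CARD('n) - 1) * v' s) has_real_derivative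
      - (\<psi> r ^ (CARD('n) - 1) * (\<bar>v r\<bar> powr (p - 1) * v r))) (at r)" if r: "r > 0" for r
  proof -
    obtain d where d: "((\<lambda>s. \<psi> s ^ (CARD('n) - 1) * v' s) has_real_derivative d) (at r)"
      using DERIV_mult[OF DERIV_power[OF psi[OF r]] dv'] by blast
    have x: "norm (r *\<^sub>R ?e) = r" "r *\<^sub>R ?e \<noteq> 0" using r by auto
    have "- model_laplacian \<psi> ?W (r *\<^sub>R ?e) = \<bar>v r\<bar> powr (p - 1) * v r"
      using sol by (simp add: solution_on_model_def v_def)
    moreover have "model_laplacian \<psi> (radial_function v) (r *\<^sub>R ?e) = d / \<psi> r ^ (CARD('n) - 1)"
      using model_laplacian_radial[OF pos dv x(2), where d = d] d x(1) by simp
    ultimately have "d = - (\<psi> r ^ (CARD('n) - 1) * (\<bar>v r\<bar> powr (p - 1) * v r))"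
      using pos[OF r] unfolding Wv by (simp add: field_simps)
    then show ?thesis using d by simp
  qed
  ultimately have "radial_profile CARD('n) p \<psi> v v'"
    using dv dv'
    by (auto simp: radial_profile_def real_differentiable_def
        intro!: DERIV_continuous_on exI[of _ "v'' 0"] intro: has_field_derivative_at_within)
  then show ?thesis using that Wv by blast
qed

section \<open>Order and sign of stable solutions\<close>

lemma continuous_on_half_line_sign:
  fixes v :: "real \<Rightarrow> real"
  assumes "continuous_on {0..} v" "\<And>r. r \<ge> 0 \<Longrightarrow> v r \<noteq> 0"
  shows "(\<forall>r\<ge>0. v r > 0) \<or> (\<forall>r\<ge>0. v r < 0)"
proof -
  have "connected (v ` {0..})"
    using assms(1) by (intro connected_continuous_image) auto
  moreover have "0 \<notin> v ` {0..}" using assms(2) by auto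
  ultimately have "\<not> (v r < 0 \<and> v s > 0)" if "r \<ge> 0" "s \<ge> 0" for r s
    using that connectedD_interval[of "v ` {0..}" "v r" "v s" 0] by auto
  then show ?thesis using assms(2) by (metis linorder_neqE_linordered_idom)
qed

theorem theorem2p14:
  fixes p :: real and \<psi> :: "real \<Rightarrow> real" and u :: "real \<Rightarrow> real \<Rightarrow> real"
    and U :: "real \<Rightarrow> real ^ 'n::finite \<Rightarrow> real"
  assumes n: "CARD('n) \<ge> 3"
    and p: "p > 1"
    and psi_C2: "C2_half_line \<psi>"
    and psi_pos: "\<And>r. r > 0 \<Longrightarrow> \<psi> r > 0"
    and psi_0: "\<psi> 0 = 0" "hderiv (hderiv \<psi>) 0 = 0" "hderiv \<psi> 0 = 1"
    and psi_mono: "\<And>r. r > 0 \<Longrightarrow> hderiv \<psi> r \<ge> 0"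
    and psi_liminf: "Liminf at_top (\<lambda>r. ereal (hderiv \<psi> r / \<psi> r)) > 0"
    and u: "\<And>\<alpha>. radial_IVP_solution CARD('n) p \<psi> \<alpha> (u \<alpha>)"
    and U: "\<And>\<alpha>. U \<alpha> = radial_function (u \<alpha>)"
  shows "(\<forall>\<alpha> \<beta>. \<alpha> \<ge> 0 \<and> \<beta> \<ge> 0 \<and> \<alpha> \<noteq> \<beta> \<and>
              stable_on_model p \<psi> (U \<alpha>) \<and> stable_on_model p \<psi> (U \<beta>) \<longrightarrow>
              (\<forall>r\<ge>0. u \<alpha> r \<noteq> u \<beta> r)) \<and>
         (\<forall>\<alpha>. \<alpha> \<noteq> 0 \<and> stable_on_model p \<psi> (U \<alpha>) \<longrightarrow>
              (\<forall>r\<ge>0. u \<alpha> r > 0) \<or> (\<forall>r\<ge>0. u \<alpha> r < 0)) \<and>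
         (\<forall>W :: real ^ 'n \<Rightarrow> real.
              solution_on_model p \<psi> W \<and> (\<exists>w. W = radial_function w) \<and>
              stable_on_model p \<psi> W \<and> (\<exists>x. W x \<noteq> 0) \<longrightarrow>
              (\<forall>x. W x > 0) \<or> (\<forall>x. W x < 0)) \<and>
         (\<forall>\<alpha> \<beta>. 0 \<le> \<beta> \<and> \<beta> < \<alpha> \<and> ereal \<alpha> < stability_threshold p \<psi> U \<longrightarrow>
              (\<forall>r\<ge>0. u \<alpha> r > u \<beta> r))"
proof -
  have psi_der: "(\<psi> has_real_derivative hderiv \<psi> r) (at r within {0..})" if "r \<ge> 0" for r
    by (rule C2_half_line_has_real_derivative(1)[OF psi_C2 that])
  then have psi_at: "(\<psi> has_real_derivative hderiv \<psi> r) (at r)" if "r > 0" for r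
    using that by (metis at_within_atLeast_0 less_imp_le)
  have psi_cont: "continuous_on {0..} \<psi>"
    using psi_der by (auto intro!: DERIV_continuous_on)
  have psi_der_0: "(\<psi> has_real_derivative 1) (at 0 within {0..})"
    using psi_der[of 0] psi_0(3) by simp
  have prof: "radial_profile CARD('n) p \<psi> (u \<alpha>) (hderiv (u \<alpha>))" for \<alpha>
    by (rule radial_IVP_solution_imp_radial_profile[OF u psi_C2 psi_pos])
  have init: "u \<alpha> 0 = \<alpha>" for \<alpha>
    using u by (simp add: radial_IVP_solution_def)
  have sign: "(\<forall>r\<ge>0. v r > 0) \<or> (\<forall>r\<ge>0. v r < 0)"
    if v: "radial_profile CARD('n) p \<psi> v v'" and "stable_on_model p \<psi> (radial_function v :: real ^ 'n \<Rightarrow> real)"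
      and "s \<ge> 0" "v s \<noteq> 0" for v v' s
  proof (rule continuous_on_half_line_sign[OF radial_profile_continuous_on[OF v]])
    show "v r \<noteq> 0" if "r \<ge> 0" for r
      using stable_radial_profile_no_zero[OF v p psi_pos psi_0(1,3) psi_der psi_mono
          \<open>stable_on_model p \<psi> (radial_function v)\<close> that _ \<open>s \<ge> 0\<close>] \<open>v s \<noteq> 0\<close>
      by blast
  qed
  have sign_u: "(\<forall>r\<ge>0. u \<alpha> r > 0) \<or> (\<forall>r\<ge>0. u \<alpha> r < 0)"
    if "\<alpha> \<noteq> 0" "stable_on_model p \<psi> (U \<alpha>)" for \<alpha>
    using sign[OF prof, of \<alpha> 0] that by (simp add: U init)
  have pos_u: "u \<alpha> r > 0" if "\<alpha> > 0" "stable_on_model p \<psi> (U \<alpha>)" "r \<ge> 0" for \<alpha> r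
    using sign_u[of \<alpha>] that init[of \<alpha>] by force
  have zero_u: "u 0 r = 0" if "r \<ge> 0" for r
    by (rule radial_profile_zero_unique[OF prof init p psi_pos psi_at psi_mono that])
  have ordered: "u \<beta> r < u \<alpha> r"
    if "0 \<le> \<beta>" "\<beta> < \<alpha>" "stable_on_model p \<psi> (U \<alpha>)" "\<beta> = 0 \<or> stable_on_model p \<psi> (U \<beta>)" "r \<ge> 0"
    for \<alpha> \<beta> r
  proof (cases "\<beta> = 0")
    case True
    then show ?thesis using pos_u[of \<alpha> r] zero_u[of r] that by simp
  next
    case False
    show ?thesis
      by (rule stable_radial_profiles_ordered[OF prof _ prof _ p psi_pos psi_0(1) psi_cont psi_der_0])
         (use that False pos_u in \<open>auto simp: init U[symmetric]\<close>)
  qed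
  show ?thesis
  proof (intro conjI allI impI)
    fix \<alpha> \<beta> r :: real
    assume "\<alpha> \<ge> 0 \<and> \<beta> \<ge> 0 \<and> \<alpha> \<noteq> \<beta> \<and> stable_on_model p \<psi> (U \<alpha>) \<and> stable_on_model p \<psi> (U \<beta>)" "r \<ge> 0"
    then show "u \<alpha> r \<noteq> u \<beta> r"
      using ordered[of \<alpha> \<beta> r] ordered[of \<beta> \<alpha> r] by (cases "\<alpha> < \<beta>") auto
  next
    fix \<alpha> assume "\<alpha> \<noteq> 0 \<and> stable_on_model p \<psi> (U \<alpha>)"
    then show "(\<forall>r\<ge>0. u \<alpha> r > 0) \<or> (\<forall>r\<ge>0. u \<alpha> r < 0)" using sign_u by blast
  next
    fix W :: "real ^ 'n \<Rightarrow> real"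
    assume W: "solution_on_model p \<psi> W \<and> (\<exists>w. W = radial_function w) \<and>
        stable_on_model p \<psi> W \<and> (\<exists>x. W x \<noteq> 0)"
    then obtain w where w: "W = radial_function w" by blast
    obtain v v' where v: "radial_profile CARD('n) p \<psi> v v'" "W = radial_function v"
      using radial_solution_on_model_profile[OF psi_pos psi_at, of p w] W unfolding w by blast
    obtain x where "W x \<noteq> 0" using W by blast
    then have "v (norm x) \<noteq> 0" by (simp add: v(2) radial_function_def)
    then show "(\<forall>x. W x > 0) \<or> (\<forall>x. W x < 0)"
      using sign[OF v(1), of "norm x"] W unfolding v(2) by (auto simp: radial_function_def)
  next
    fix \<alpha> \<beta> r :: real
    assume *: "0 \<le> \<beta> \<and> \<beta> < \<alpha> \<and> ereal \<alpha> < stability_threshold p \<psi> U" and "r \<ge> 0"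
    then obtain \<gamma> where \<gamma>: "\<alpha> < \<gamma>" "\<And>\<beta>. \<beta> \<in> {0<..<\<gamma>} \<Longrightarrow> stable_on_model p \<psi> (U \<beta>)"
      by (auto simp: stability_threshold_def less_Sup_iff)
    show "u \<beta> r < u \<alpha> r"
      using * \<open>r \<ge> 0\<close> \<gamma>(1) by (intro ordered) (auto intro: \<gamma>(2))
  qed
qed

end
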